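(* Let $d\ge 1$, let $Y$ be a $\mathbb Z^d$-SFT, and let $P$ be a property of $\mathbb Z^d$-SFTs such that: (i) if an SFT $X$ satisfies $P$, then any SFT conjugate to $X$ or containing $X$ satisfies $P$; (ii) $Y$ satisfies $P$, and any strict subshift $X\subsetneq Y$ does not satisfy $P$; (iii) there is an algorithm that, given a finite set of forbidden patterns, halts if and only if the associated SFT does not satisfy $P$. Then the problem "$X\simeq Y$ with effective inputs $X$" is in $D(\Sigma^0_1)$.
   Context: For a finite alphabet $\mathcal A$ (a finite subset of $\mathbb N$), $\mathbb Z^d$ acts on $\mathcal A^{\mathbb Z^d}$ by $\sigma^u(x)(v)=x(v+u)$. A pattern is a function $p\colon S\to\mathcal A$ with $S\subset\mathbb Z^d$ finite; it appears in $x$ if $\sigma^u(x)|_S=p$ for some $u$. For a set $\mathcal F$ of patterns, $X_{\mathcal F}$ is the set of configurations in which no pattern from $\mathcal F$ appears. A subshift is a set of the form $X_{\mathcal F}$ (possibly empty); it is an SFT if $\mathcal F$ can be taken finite (the SFT associated with $\mathcal F$ and its alphabet is $X_{\mathcal F}$), and effective if $\mathcal F$ can be taken recursively enumerable. $P$ is a property that applies to SFTs only. $X\simeq Y$ ($X$ and $Y$ are conjugate) means there is a continuous, shift-commuting bijection $X\to Y$. The subshift $Y$ is a fixed parameter. The problem is: given an effective $\mathbb Z^d$-subshift $X$, specified by an alphabet and a Turing machine enumerating a defining set of forbidden patterns, determine whether $X\simeq Y$. A set belongs to $D(\Sigma^0_1)$ when it is the difference of two $\Sigma^0_1$ sets.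 *)

theory Defs
  imports "HOL-Analysis.Analysis" "HOL-Library.Nat_Bijection"
begin

section \<open>Subshifts over \<open>\<int>\<^sup>d\<close>\<close>

text \<open>The group \<open>\<int>\<^sup>d\<close> is \<^typ>\<open>int ^ 'd\<close> with \<open>d = CARD('d) \<ge> 1\<close>. Symbols are natural numbers, so
  configurations over all alphabets live in one type, which carries the library's product
  topology of the discrete space \<^typ>\<open>nat\<close>; for finite \<open>A\<close> the subspace topology on
  \<open>full_shift A\<close> is the usual product topology.\<close>

type_synonym 'd config = "int ^ 'd \<Rightarrow> nat"
type_synonym 'd pattern = "int ^ 'd \<Rightarrow> nat option"

definition shift :: "int ^ 'd::finite \<Rightarrow> 'd config \<Rightarrow> 'd config" where
  "shift u x = (\<lambda>v. x (v + u))"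

definition full_shift :: "nat set \<Rightarrow> 'd::finite config set" where
  "full_shift A = {x. range x \<subseteq> A}"

text \<open>The support of a pattern is its domain as a partial map.\<close>

definition pattern_over :: "nat set \<Rightarrow> 'd::finite pattern \<Rightarrow> bool" where
  "pattern_over A p \<longleftrightarrow> finite (dom p) \<and> ran p \<subseteq> A"

definition appears :: "'d::finite pattern \<Rightarrow> 'd config \<Rightarrow> bool" where
  "appears p x \<longleftrightarrow> (\<exists>u. \<forall>v\<in>dom p. p v = Some (shift u x v))"

definition avoiding :: "nat set \<Rightarrow> 'd::finite pattern set \<Rightarrow> 'd config set" where
  "avoiding A F = {x \<in> full_shift A. \<forall>p\<in>F. \<not> appears p x}"

definition is_subshift :: "'d::finite config set \<Rightarrow> bool" where
  "is_subshift X \<longleftrightarrow> (\<exists>A F. finite A \<and> (\<forall>p\<in>F. pattern_over A p) \<and> X = avoiding A F)"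

definition is_SFT :: "'d::finite config set \<Rightarrow> bool" where
  "is_SFT X \<longleftrightarrow>
    (\<exists>A F. finite A \<and> finite F \<and> (\<forall>p\<in>F. pattern_over A p) \<and> X = avoiding A F)"

definition conjugate :: "'d::finite config set \<Rightarrow> 'd config set \<Rightarrow> bool" where
  "conjugate X Y \<longleftrightarrow>
    (\<exists>\<phi>. bij_betw \<phi> X Y \<and> continuous_on X \<phi> \<and> (\<forall>u. \<forall>x\<in>X. \<phi> (shift u x) = shift u (\<phi> x)))"


section \<open>Turing machines\<close>

text \<open>A machine is a finite table of entries \<open>((q, a), (b, m, q'))\<close>: in state \<open>q\<close> scanning \<open>a\<close>,
  write \<open>b\<close>, move according to \<open>m\<close> and enter state \<open>q'\<close>. If several entries have the same left-hand
  side, the first one counts; the machine halts when no entry applies. State 0 is initial and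
  symbol 0 is blank. The tape alphabet consists of 0, 1 and the symbols in the table.\<close>

datatype move = MoveL | MoveR

type_synonym tm = "((nat \<times> nat) \<times> (nat \<times> move \<times> nat)) list"

text \<open>In \<open>(q, l, r)\<close> the list \<open>l\<close> is the tape to the left of the head, read outwards, and \<open>r\<close> is the
  tape from the scanned cell rightwards; cells beyond the ends of the lists are blank.\<close>

type_synonym tm_config = "nat \<times> nat list \<times> nat list"

definition first_cell :: "nat list \<Rightarrow> nat" where
  "first_cell xs = (case xs of [] \<Rightarrow> 0 | x # _ \<Rightarrow> x)"

fun tm_step :: "tm \<Rightarrow> tm_config \<Rightarrow> tm_config option" where
  "tm_step M (q, l, r) =
    (case map_of M (q, first_cell r) of
       None \<Rightarrow> None
     | Some (b, MoveL, q') \<Rightarrow> Some (q', tl l, first_cell l # b # tl r)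
     | Some (b, MoveR, q') \<Rightarrow> Some (q', b # l, tl r))"

text \<open>Numbers are input in unary, \<open>n\<close> as \<open>n + 1\<close> ones; the output is the number of ones left on
  the tape.\<close>

definition tm_init :: "nat \<Rightarrow> tm_config" where
  "tm_init n = (0, [], replicate (Suc n) 1)"

fun tm_result :: "tm_config \<Rightarrow> nat" where
  "tm_result (q, l, r) = count_list l 1 + count_list r 1"

definition tm_outputs :: "tm \<Rightarrow> nat \<Rightarrow> nat \<Rightarrow> bool" where
  "tm_outputs M n m \<longleftrightarrow>
    (\<exists>c. (\<lambda>c c'. tm_step M c = Some c')\<^sup>*\<^sup>* (tm_init n) c \<and> tm_step M c = None \<and> tm_result c = m)"

definition tm_halts :: "tm \<Rightarrow> nat \<Rightarrow> bool" where
  "tm_halts M n \<longleftrightarrow> (\<exists>m. tm_outputs M n m)"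


section \<open>Coding of inputs\<close>

fun move_encode :: "move \<Rightarrow> nat" where
  "move_encode MoveL = 0"
| "move_encode MoveR = 1"

fun entry_encode :: "(nat \<times> nat) \<times> (nat \<times> move \<times> nat) \<Rightarrow> nat" where
  "entry_encode ((q, a), (b, m, q')) =
    prod_encode (prod_encode (q, a), prod_encode (b, prod_encode (move_encode m, q')))"

definition tm_encode :: "tm \<Rightarrow> nat" where
  "tm_encode M = list_encode (map entry_encode M)"

text \<open>Patterns have no canonical listing, so we decode rather than encode: every number codes a
  pattern (for repeated positions the first entry counts) and every pattern has a code. The
  coordinates of a vector are numbered \<open>0, ..., d - 1\<close> by a fixed bijection, and missing
  coordinates are 0.\<close>

definition vec_decode :: "nat \<Rightarrow> int ^ 'd::finite" where
  "vec_decode n = (\<chi> i. let xs = list_decode n; k = to_nat_on (UNIV :: 'd set) i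
                        in if k < length xs then int_decode (xs ! k) else 0)"

definition pattern_decode :: "nat \<Rightarrow> 'd::finite pattern" where
  "pattern_decode n =
    map_of (map (\<lambda>e. (vec_decode (fst (prod_decode e)), snd (prod_decode e))) (list_decode n))"

lemma vec_decode_surj: "\<exists>n. vec_decode n = (v :: int ^ 'd::finite)"
proof -
  let ?t = "to_nat_on (UNIV :: 'd set)"
  let ?xs = "map (\<lambda>k. int_encode (v $ (inv_into UNIV ?t k))) [0..<CARD('d)]"
  have bij: "bij_betw ?t UNIV {..<CARD('d)}"
    by (rule to_nat_on_finite) simp
  have "?t i < CARD('d)" "inv_into UNIV ?t (?t i) = i" for i
    using bij by (auto simp: bij_betw_def)
  then have "vec_decode (list_encode ?xs) = v"
    by (simp add: vec_decode_def vec_eq_iff)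
  then show ?thesis ..
qed

lemma pattern_decode_surj:
  assumes "finite (dom p)"
  shows "\<exists>n. pattern_decode n = (p :: 'd::finite pattern)"
proof -
  obtain vs where vs: "set vs = dom p"
    using finite_list[OF assms] by blast
  define xs where "xs = map (\<lambda>v. (v, the (p v))) vs"
  have xs: "map_of xs = p"
    by (auto simp: xs_def map_of_map_restrict restrict_map_def vs dom_def fun_eq_iff)
  obtain c :: "int ^ 'd \<Rightarrow> nat" where c: "vec_decode (c v) = v" for v
    using vec_decode_surj by metis
  have "pattern_decode (list_encode (map (\<lambda>(v, a). prod_encode (c v, a)) xs)) = p"
    by (simp add: pattern_decode_def o_def case_prod_beta c xs prod.collapse)
  then show ?thesis ..
qed

text \<open>The machine \<open>M\<close> enumerates the range of the partial function it computes; outputs that are not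
  patterns over \<open>A\<close> are disregarded (they could not appear in a configuration over \<open>A\<close>).\<close>

definition enumerated_patterns :: "nat set \<Rightarrow> tm \<Rightarrow> 'd::finite pattern set" where
  "enumerated_patterns A M = {p. pattern_over A p \<and> (\<exists>n m. tm_outputs M n m \<and> pattern_decode m = p)}"

definition effective_subshift :: "nat set \<Rightarrow> tm \<Rightarrow> 'd::finite config set" where
  "effective_subshift A M = avoiding A (enumerated_patterns A M)"

text \<open>Halting on an input is required only for lists of codes of patterns over the given alphabet;
  the behaviour on other inputs is unconstrained.\<close>

definition semidecides_SFT :: "tm \<Rightarrow> ('d::finite config set \<Rightarrow> bool) \<Rightarrow> bool" where
  "semidecides_SFT M Q \<longleftrightarrow>
    (\<forall>A cs. finite A \<longrightarrow> (\<forall>c\<in>set cs. pattern_over A (pattern_decode c :: 'd pattern)) \<longrightarrow>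
      (tm_halts M (prod_encode (set_encode A, list_encode cs)) \<longleftrightarrow>
       Q (avoiding A (pattern_decode ` set cs))))"

definition conjugacy_problem :: "'d::finite config set \<Rightarrow> nat set" where
  "conjugacy_problem Y =
    {prod_encode (set_encode A, tm_encode M) | A M.
      finite A \<and> conjugate (effective_subshift A M) Y}"


section \<open>Recursive functions, \<open>\<Sigma>\<^sup>0\<^sub>1\<close> and \<open>D(\<Sigma>\<^sup>0\<^sub>1)\<close>\<close>

text \<open>Total recursive functions of \<open>n\<close> arguments; only the values on lists of length \<open>n\<close> matter.
  Minimisation is restricted to regular functions, so that no partial functions arise.\<close>

inductive recursive_fun :: "nat \<Rightarrow> (nat list \<Rightarrow> nat) \<Rightarrow> bool" where
  zero: "recursive_fun n (\<lambda>xs. 0)"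
| succ: "recursive_fun 1 (\<lambda>xs. Suc (xs ! 0))"
| proj: "i < n \<Longrightarrow> recursive_fun n (\<lambda>xs. xs ! i)"
| comp: "recursive_fun (length gs) f \<Longrightarrow> (\<And>g. g \<in> set gs \<Longrightarrow> recursive_fun n g) \<Longrightarrow>
    recursive_fun n (\<lambda>xs. f (map (\<lambda>g. g xs) gs))"
| prim_rec: "recursive_fun n f \<Longrightarrow> recursive_fun (Suc (Suc n)) g \<Longrightarrow>
    recursive_fun (Suc n) (\<lambda>xs. rec_nat (f (tl xs)) (\<lambda>k r. g (k # r # tl xs)) (hd xs))"
| minim: "recursive_fun (Suc n) f \<Longrightarrow> (\<And>xs. length xs = n \<Longrightarrow> \<exists>y. f (y # xs) = 0) \<Longrightarrow>
    recursive_fun n (\<lambda>xs. LEAST y. f (y # xs) = 0)"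

definition recursive_rel :: "(nat \<Rightarrow> nat \<Rightarrow> bool) \<Rightarrow> bool" where
  "recursive_rel R \<longleftrightarrow> (\<exists>f. recursive_fun 2 f \<and> (\<forall>x y. f [x, y] = (if R x y then 1 else 0)))"

definition Sigma01 :: "nat set \<Rightarrow> bool" where
  "Sigma01 S \<longleftrightarrow> (\<exists>R. recursive_rel R \<and> S = {x. \<exists>y. R x y})"

definition D_Sigma01 :: "nat set \<Rightarrow> bool" where
  "D_Sigma01 S \<longleftrightarrow> (\<exists>B C. Sigma01 B \<and> Sigma01 C \<and> S = B - C)"

end

theory Submission
  imports Defs
begin

text \<open>Given an effective subshift \<open>X\<close>, let \<open>X\<^sub>F\<close> be the SFT of a finite set \<open>F\<close> of its enumerated
  forbidden patterns. By compactness, \<open>X\<close> embeds into \<open>Y\<close> by a block code with a block code as left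
  inverse iff some \<open>X\<^sub>F\<close> does, and this is witnessed by a finite certificate. The set of inputs that embed
  and the set of inputs with some \<open>X\<^sub>F\<close> outside \<open>P\<close> are thus both \<open>\<Sigma>\<^sup>0\<^sub>1\<close>. Their difference is the
  conjugacy problem. If \<open>X\<close> is conjugate to \<open>Y\<close> then \<open>X\<close> is an SFT with \<open>P\<close>, and so is every
  \<open>X\<^sub>F \<supseteq> X\<close>. Conversely, if \<open>X\<^sub>F\<close> embeds into \<open>Y\<close> and all \<open>X\<^sub>G\<close> with \<open>G \<supseteq> F\<close> satisfy \<open>P\<close>,
  then the image of each such \<open>X\<^sub>G\<close> is an SFT in \<open>Y\<close> with \<open>P\<close>, hence equals \<open>Y\<close>; so all these \<open>X\<^sub>G\<close>
  coincide with \<open>X\<close>.\<close>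

section \<open>Recursive functions of natural numbers\<close>

text \<open>Surjectivity onto \<open>Y\<close> has no finite witness, whereas injectivity has one as
  soon as a left inverse block code belongs to the data. The search therefore looks only for
  embeddings, and surjectivity is forced afterwards through \<open>P\<close>. That two block codes
  embed an SFT X_F into \<open>Y\<close> is a statement about all points of X_F. It becomes a finite
  check because it is local at the origin: compactness yields a finite window on which every
  assignment of symbols either satisfies the condition or visibly contains a forbidden pattern at
  one of finitely many positions. It is never necessary to decide whether an assignment extends to a
  point of X_F. Both searches run over lists of codes that the input machine has output and that are
  patterns over the alphabet, since assumption (iii) constrains the semidecision machine on such
  lists only. \<open>Sigma01\<close> is defined by recursive functions of numbers, so table lookup,
  pattern decoding, machine runs and the check of a certificate all have to be recursive. The typed
  predicate \<open>computable\<close> reduces this to rules that follow the syntax of a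
  term.\<close>

definition recursive_on :: "nat \<Rightarrow> (nat list \<Rightarrow> nat) \<Rightarrow> bool" where
  "recursive_on n f \<longleftrightarrow> (\<exists>g. recursive_fun n g \<and> (\<forall>xs. length xs = n \<longrightarrow> g xs = f xs))"

text \<open>This closure is the purpose of \<open>recursive_on\<close>: a
  \<open>recursive_fun\<close> also has values on lists of the wrong length, which its construction
  dictates and which do not matter.\<close>

lemma recursive_on_cong:
  assumes "recursive_on n f" "\<And>xs. length xs = n \<Longrightarrow> f xs = g xs"
  shows "recursive_on n g"
  using assms unfolding recursive_on_def by metis

lemma recursive_on_nth: "i < n \<Longrightarrow> recursive_on n (\<lambda>xs. xs ! i)"
  unfolding recursive_on_def using recursive_fun.proj by blast

lemma recursive_on_compose:
  assumes f: "recursive_on m f" and gs: "\<And>i. i < m \<Longrightarrow> recursive_on n (g i)"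
  shows "recursive_on n (\<lambda>xs. f (map (\<lambda>i. g i xs) [0..<m]))"
proof -
  obtain f' where f': "recursive_fun m f'" "\<And>xs. length xs = m \<Longrightarrow> f' xs = f xs"
    using f unfolding recursive_on_def by blast
  obtain g' where g': "\<And>i. i < m \<Longrightarrow> recursive_fun n (g' i)"
      "\<And>i xs. i < m \<Longrightarrow> length xs = n \<Longrightarrow> g' i xs = g i xs"
    using gs unfolding recursive_on_def by metis
  have "recursive_fun n (\<lambda>xs. f' (map (\<lambda>h. h xs) (map g' [0..<m])))"
    by (rule recursive_fun.comp) (use f' g' in auto)
  moreover have "f' (map (\<lambda>h. h xs) (map g' [0..<m])) = f (map (\<lambda>i. g i xs) [0..<m])"
    if "length xs = n" for xs
    using that g'(2) by (subst f'(2)) (auto simp: o_def intro!: arg_cong[where f = f])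
  ultimately show ?thesis
    unfolding recursive_on_def by blast
qed

lemma recursive_on_rec_nat:
  assumes f: "recursive_on n f" and g: "recursive_on (Suc (Suc n)) g"
  shows "recursive_on (Suc n) (\<lambda>xs. rec_nat (f (tl xs)) (\<lambda>k r. g (k # r # tl xs)) (hd xs))"
proof -
  obtain f' where f': "recursive_fun n f'" "\<And>xs. length xs = n \<Longrightarrow> f' xs = f xs"
    using f unfolding recursive_on_def by blast
  obtain g' where g': "recursive_fun (Suc (Suc n)) g'"
      "\<And>xs. length xs = Suc (Suc n) \<Longrightarrow> g' xs = g xs"
    using g unfolding recursive_on_def by blast
  have "rec_nat (f' (tl xs)) (\<lambda>k r. g' (k # r # tl xs)) m =
      rec_nat (f (tl xs)) (\<lambda>k r. g (k # r # tl xs)) m" if "length xs = Suc n" for xs m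
    using that by (induction m) (auto simp: f' g')
  then show ?thesis
    using recursive_fun.prim_rec[OF f'(1) g'(1)] unfolding recursive_on_def by blast
qed

definition rec1 :: "(nat \<Rightarrow> nat) \<Rightarrow> bool" where
  "rec1 f \<longleftrightarrow> recursive_on 1 (\<lambda>xs. f (xs ! 0))"

definition rec2 :: "(nat \<Rightarrow> nat \<Rightarrow> nat) \<Rightarrow> bool" where
  "rec2 f \<longleftrightarrow> recursive_on 2 (\<lambda>xs. f (xs ! 0) (xs ! 1))"

text \<open>Application rules in this form decompose an explicit term along its syntax, so that its
  recursiveness is proved by \<open>intro\<close>.\<close>

lemma recursive_on_app1:
  assumes "rec1 f" "recursive_on n g"
  shows "recursive_on n (\<lambda>xs. f (g xs))"
  using recursive_on_compose[of 1 "\<lambda>xs. f (xs ! 0)" n "\<lambda>i. g"] assms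
  by (simp add: rec1_def)

lemma recursive_on_app2:
  assumes "rec2 f" "recursive_on n g" "recursive_on n h"
  shows "recursive_on n (\<lambda>xs. f (g xs) (h xs))"
  using recursive_on_compose[of 2 "\<lambda>xs. f (xs ! 0) (xs ! 1)" n "\<lambda>i. if i = 0 then g else h"] assms
  by (simp add: rec2_def numeral_2_eq_2)

lemma recursive_on_Suc: "recursive_on n f \<Longrightarrow> recursive_on n (\<lambda>xs. Suc (f xs))"
  by (rule recursive_on_app1[of Suc])
    (use recursive_fun.succ in \<open>auto simp: rec1_def recursive_on_def\<close>)

lemma recursive_on_const: "recursive_on n (\<lambda>xs. c)"
proof (induction c)
  case 0
  show ?case
    unfolding recursive_on_def using recursive_fun.zero by blast
next
  case (Suc c)
  then show ?case
    by (rule recursive_on_Suc)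
qed

text \<open>Recursion on the first argument with the second as parameter; the order of the arguments
  of \<open>g\<close> is the one in \<open>prim_rec\<close>.\<close>

lemma rec2_rec_nat:
  assumes f: "rec1 f" and g: "recursive_on 3 (\<lambda>xs. g (xs ! 0) (xs ! 1) (xs ! 2))"
  shows "rec2 (\<lambda>m x. rec_nat (f x) (\<lambda>k r. g k r x) m)"
proof -
  have g': "recursive_on (Suc (Suc 1)) (\<lambda>xs. g (xs ! 0) (xs ! 1) (xs ! 2))"
    using g by (simp add: eval_nat_numeral)
  show ?thesis
    unfolding rec2_def
    using recursive_on_rec_nat[OF f[unfolded rec1_def] g']
    unfolding Suc_1
    by (rule recursive_on_cong) (simp add: hd_conv_nth nth_tl length_0_conv[symmetric] del: length_0_conv)
qed

lemmas recursive_on_basic = recursive_on_nth recursive_on_const recursive_on_Suc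

lemma rec2_swap: "rec2 f \<Longrightarrow> rec2 (\<lambda>x y. f y x)"
  unfolding rec2_def[of "\<lambda>x y. f y x"] by (intro recursive_on_app2[of f] recursive_on_nth) simp_all

lemma rec1_rec_nat:
  assumes "rec2 g"
  shows "rec1 (\<lambda>m. rec_nat a g m)"
proof -
  have "rec2 (\<lambda>m x. rec_nat a (\<lambda>k r. g k r) m)"
    by (rule rec2_rec_nat; (unfold rec1_def)?;
        intro recursive_on_app2[OF assms] recursive_on_basic; simp)
  then show ?thesis
    unfolding rec1_def
    by (rule recursive_on_app2[of "\<lambda>m x. rec_nat a g m" 1 "\<lambda>xs. xs ! 0" "\<lambda>xs. 0"])
      (intro recursive_on_basic; simp)+
qed

section \<open>Arithmetic and the Cantor pairing function\<close>

lemma rec2_add: "rec2 (+)"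
proof -
  have "rec2 (\<lambda>m x. rec_nat x (\<lambda>k r. Suc r) m)"
    by (rule rec2_rec_nat; (unfold rec1_def)?; intro recursive_on_basic; simp)
  moreover have "rec_nat x (\<lambda>k r. Suc r) m = m + x" for m x
    by (induction m) auto
  ultimately show ?thesis
    by simp
qed

lemma rec1_pred: "rec1 (\<lambda>x. x - 1)"
proof -
  have "rec1 (\<lambda>m. rec_nat 0 (\<lambda>k r. k) m)"
    by (rule rec1_rec_nat; unfold rec2_def; intro recursive_on_basic; simp)
  moreover have "rec_nat 0 (\<lambda>k r. k) m = m - 1" for m
    by (cases m) auto
  ultimately show ?thesis
    by simp
qed

lemma rec2_diff: "rec2 (-)"
proof -
  have "rec2 (\<lambda>m x. rec_nat x (\<lambda>k r. r - 1) m)"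
    by (rule rec2_rec_nat; (unfold rec1_def)?;
        intro recursive_on_app1[OF rec1_pred] recursive_on_basic; simp)
  moreover have "rec_nat x (\<lambda>k r. r - 1) m = x - m" for m x
    by (induction m) auto
  ultimately show ?thesis
    by (auto dest: rec2_swap)
qed

lemma rec1_triangle: "rec1 triangle"
proof -
  have "rec1 (\<lambda>m. rec_nat 0 (\<lambda>k r. r + Suc k) m)"
    by (rule rec1_rec_nat; unfold rec2_def;
        intro recursive_on_basic recursive_on_app2[OF rec2_add]; simp)
  moreover have "rec_nat 0 (\<lambda>k r. r + Suc k) m = triangle m" for m
    by (induction m) auto
  ultimately show ?thesis
    by simp
qed

lemma rec2_prod_encode: "rec2 (\<lambda>x y. prod_encode (x, y))"
  unfolding prod_encode_def rec2_def
  by (simp, intro recursive_on_basic recursive_on_app2[OF rec2_add] recursive_on_app1[OF rec1_triangle]; simp)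

text \<open>The index of the diagonal of the Cantor enumeration.\<close>

definition prod_sum :: "nat \<Rightarrow> nat" where
  "prod_sum n = fst (prod_decode n) + snd (prod_decode n)"

text \<open>Since \<open>prod_encode (x, y) = triangle (x + y) + x\<close>, the diagonals are the
  intervals between consecutive triangle numbers.\<close>

lemma prod_sum_eqI: "triangle s \<le> n \<Longrightarrow> n < triangle (Suc s) \<Longrightarrow> prod_sum n = s"
proof -
  assume "triangle s \<le> n" "n < triangle (Suc s)"
  then have "n = prod_encode (n - triangle s, s - (n - triangle s))"
    by (simp add: prod_encode_def)
  then have "prod_decode n = (n - triangle s, s - (n - triangle s))"
    by (metis prod_encode_inverse)
  then show ?thesis
    using \<open>n < triangle (Suc s)\<close> by (simp add: prod_sum_def)
qed

lemma triangle_prod_sum: "triangle (prod_sum n) \<le> n" "n < triangle (Suc (prod_sum n))"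
proof -
  have "n = triangle (prod_sum n) + fst (prod_decode n)"
    using prod_decode_inverse[of n] unfolding prod_encode_def prod_sum_def
    by (simp add: case_prod_beta)
  moreover have "fst (prod_decode n) \<le> prod_sum n"
    by (simp add: prod_sum_def)
  ultimately show "triangle (prod_sum n) \<le> n" "n < triangle (Suc (prod_sum n))"
    unfolding triangle_Suc by linarith+
qed

text \<open>The diagonal changes exactly when \<open>Suc n\<close> reaches the next triangle number;
  truncated subtraction expresses this test as 0 or 1. Decoding thus becomes a primitive recursion
  without any search.\<close>

lemma prod_sum_Suc:
  "prod_sum (Suc n) = prod_sum n + (1 - (triangle (Suc (prod_sum n)) - Suc n))"
proof (cases "triangle (Suc (prod_sum n)) \<le> Suc n")
  case True
  then have "Suc n = triangle (Suc (prod_sum n))"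
    using triangle_prod_sum(2)[of n] by simp
  then show ?thesis
    by (simp add: prod_sum_eqI)
next
  case False
  then have "prod_sum (Suc n) = prod_sum n"
    using triangle_prod_sum(1)[of n] by (intro prod_sum_eqI) auto
  then show ?thesis
    using False by auto
qed

lemma rec1_prod_sum: "rec1 prod_sum"
proof -
  have "rec1 (\<lambda>m. rec_nat 0 (\<lambda>k r. r + (1 - (triangle (Suc r) - Suc k))) m)"
    by (rule rec1_rec_nat; unfold rec2_def; intro recursive_on_app2[OF rec2_add]
        recursive_on_app2[OF rec2_diff] recursive_on_app1[OF rec1_triangle] recursive_on_basic; simp)
  moreover have "rec_nat 0 (\<lambda>k r. r + (1 - (triangle (Suc r) - Suc k))) m = prod_sum m" for m
  proof (induction m)
    case 0
    have "prod_sum 0 = 0"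
      by (rule prod_sum_eqI) simp_all
    then show ?case
      by simp
  next
    case (Suc m)
    show ?case
      by (simp only: prod_sum_Suc old.nat.rec Suc.IH)
  qed
  ultimately show ?thesis
    by simp
qed

lemma fst_prod_decode: "fst (prod_decode n) = n - triangle (prod_sum n)"
  using prod_decode_inverse[of n] unfolding prod_encode_def prod_sum_def
  by (metis (no_types, lifting) add_diff_cancel_left' case_prod_beta)

lemma snd_prod_decode: "snd (prod_decode n) = prod_sum n - (n - triangle (prod_sum n))"
  unfolding fst_prod_decode[symmetric] by (simp add: prod_sum_def)

lemma rec1_fst_prod_decode: "rec1 (\<lambda>n. fst (prod_decode n))"
  unfolding fst_prod_decode rec1_def
  by (intro recursive_on_basic recursive_on_app2[OF rec2_diff] recursive_on_app1[OF rec1_triangle]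
      recursive_on_app1[OF rec1_prod_sum]) simp_all

lemma rec1_snd_prod_decode: "rec1 (\<lambda>n. snd (prod_decode n))"
  unfolding snd_prod_decode rec1_def
  by (intro recursive_on_basic recursive_on_app2[OF rec2_diff] recursive_on_app1[OF rec1_triangle]
      recursive_on_app1[OF rec1_prod_sum]) simp_all

lemma rec1_id: "rec1 (\<lambda>x. x)"
  unfolding rec1_def by (intro recursive_on_basic) simp

lemma rec1_const: "rec1 (\<lambda>x. c)"
  unfolding rec1_def by (intro recursive_on_basic)

lemma rec1_compose: "rec1 f \<Longrightarrow> rec1 g \<Longrightarrow> rec1 (\<lambda>x. f (g x))"
  unfolding rec1_def[of g] by (auto simp: rec1_def[of "\<lambda>x. f (g x)"] intro: recursive_on_app1)

lemma rec1_app2: "rec2 f \<Longrightarrow> rec1 g \<Longrightarrow> rec1 h \<Longrightarrow> rec1 (\<lambda>x. f (g x) (h x))"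
  unfolding rec1_def by (rule recursive_on_app2)

text \<open>Parameter, counter and previous value are packed into one number, so that the step
  function can be the unary realiser of a function on a coded type.\<close>

lemma rec1_primrec:
  assumes f: "rec1 f" and g: "rec1 g" and h: "rec1 h"
  shows "rec1 (\<lambda>x. rec_nat (f x) (\<lambda>k r. g (prod_encode (x, prod_encode (k, r)))) (h x))"
proof -
  have "rec2 (\<lambda>m x. rec_nat (f x) (\<lambda>k r. g (prod_encode (x, prod_encode (k, r)))) m)"
    by (rule rec2_rec_nat[OF f])
      (intro recursive_on_basic recursive_on_app1[OF g] recursive_on_app2[OF rec2_prod_encode]; simp)
  from rec1_app2[OF this h rec1_id] show ?thesis .
qed

section \<open>Computability on coded types\<close>

text \<open>Since \<open>enc \<circ> dec\<close> is recursive, every number can be normalised to a code: functions on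
  the type act on all numbers and quantifiers over the type become quantifiers over numbers.\<close>

class enc =
  fixes enc :: "'a \<Rightarrow> nat" and dec :: "nat \<Rightarrow> 'a"
  assumes dec_enc [simp]: "dec (enc a) = a"
    and rec1_enc_dec: "rec1 (\<lambda>n. enc (dec n))"

lemma enc_eq_iff [simp]: "enc x = enc y \<longleftrightarrow> x = y"
  by (metis dec_enc)

definition computable :: "('a::enc \<Rightarrow> 'b::enc) \<Rightarrow> bool" where
  "computable f \<longleftrightarrow> rec1 (\<lambda>n. enc (f (dec n)))"

named_theorems computable

lemma computable_id [computable]: "computable (\<lambda>x. x)"
  unfolding computable_def by (rule rec1_enc_dec)

lemma computable_const [computable]: "computable (\<lambda>x. c)"
  unfolding computable_def by (rule rec1_const)

lemma computable_compose:
  assumes "computable f" "computable g"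
  shows "computable (\<lambda>x. f (g x))"
  using rec1_compose[OF assms[unfolded computable_def]] by (simp add: computable_def)

instantiation nat :: enc
begin
definition enc_nat :: "nat \<Rightarrow> nat" where [simp]: "enc_nat n = n"
definition dec_nat :: "nat \<Rightarrow> nat" where [simp]: "dec_nat n = n"
instance by standard (auto simp: rec1_id)
end

instantiation prod :: (enc, enc) enc
begin
definition enc_prod :: "'a \<times> 'b \<Rightarrow> nat" where
  "enc_prod p = prod_encode (enc (fst p), enc (snd p))"
definition dec_prod :: "nat \<Rightarrow> 'a \<times> 'b" where
  "dec_prod n = (dec (fst (prod_decode n)), dec (snd (prod_decode n)))"
instance
proof
  show "rec1 (\<lambda>n. enc (dec n :: 'a \<times> 'b))"
    unfolding enc_prod_def dec_prod_def fst_conv snd_conv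
    by (intro rec1_app2[OF rec2_prod_encode] rec1_compose[OF rec1_enc_dec]
        rec1_fst_prod_decode rec1_snd_prod_decode)
qed (simp add: enc_prod_def dec_prod_def)
end

instantiation bool :: enc
begin
definition enc_bool :: "bool \<Rightarrow> nat" where "enc_bool b = (if b then 1 else 0)"
definition dec_bool :: "nat \<Rightarrow> bool" where "dec_bool n \<longleftrightarrow> n \<noteq> 0"
instance
proof
  have "enc (dec n :: bool) = 1 - (1 - n)" for n
    by (auto simp: enc_bool_def dec_bool_def)
  then show "rec1 (\<lambda>n. enc (dec n :: bool))"
    by (simp del: One_nat_def add: rec1_app2[OF rec2_diff] rec1_const rec1_id)
qed (simp add: enc_bool_def dec_bool_def)
end

lemma computable_Pair [computable]:
  assumes "computable f" "computable g"
  shows "computable (\<lambda>x. (f x, g x))"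
  using rec1_app2[OF rec2_prod_encode assms[unfolded computable_def]]
  by (simp add: computable_def enc_prod_def)

lemma computable_fst [computable]: "computable f \<Longrightarrow> computable (\<lambda>x. fst (f x))"
  by (rule computable_compose[of fst])
    (auto simp: computable_def dec_prod_def intro: rec1_compose[OF rec1_enc_dec rec1_fst_prod_decode])

lemma computable_snd [computable]: "computable f \<Longrightarrow> computable (\<lambda>x. snd (f x))"
  by (rule computable_compose[of snd])
    (auto simp: computable_def dec_prod_def intro: rec1_compose[OF rec1_enc_dec rec1_snd_prod_decode])

text \<open>A function of two arguments is called computable through its uncurried form; this rule
  returns to the curried application that occurs in terms.\<close>

lemma computable_split:
  "computable (\<lambda>z. f (fst z) (snd z)) \<Longrightarrow> computable g \<Longrightarrow> computable h \<Longrightarrow>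
    computable (\<lambda>x. f (g x) (h x))"
  using computable_compose[of "\<lambda>z. f (fst z) (snd z)" "\<lambda>x. (g x, h x)"]
  by (simp add: computable_Pair)

lemma computable_rec_nat [computable]:
  fixes f :: "'a::enc \<Rightarrow> 'b::enc"
  assumes f: "computable f"
    and g: "computable (\<lambda>z. g (fst z) (fst (snd z)) (snd (snd z)))" and h: "computable h"
  shows "computable (\<lambda>x. rec_nat (f x) (g x) (h x))"
proof -
  \<comment> \<open>\<open>G\<close> is the step function on codes, unpacking the triple of
    \<open>rec1_primrec\<close>. The counter is a number already and stays undecoded.\<close>
  define G where "G n = enc (g (dec (fst (prod_decode n))) (fst (prod_decode (snd (prod_decode n))))
      (dec (snd (prod_decode (snd (prod_decode n))))))" for n
  have G: "rec1 G"
    using g by (simp add: computable_def G_def[abs_def] dec_prod_def)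
  have "enc (rec_nat (f (dec n)) (g (dec n)) m) =
      rec_nat (enc (f (dec n))) (\<lambda>k r. G (prod_encode (n, prod_encode (k, r)))) m" for n m
  proof (induction m)
    case (Suc m)
    show ?case
      unfolding old.nat.rec Suc.IH[symmetric] by (simp add: G_def)
  qed simp
  then show ?thesis
    unfolding computable_def
    using rec1_primrec[OF f[unfolded computable_def] G h[unfolded computable_def]]
    by simp
qed

lemma computable_enc [computable]: "computable f \<Longrightarrow> computable (\<lambda>x. enc (f x))"
  by (simp add: computable_def)

lemma computable_dec [computable]: "computable f \<Longrightarrow> computable (\<lambda>x. dec (f x))"
  by (rule computable_compose[of dec]) (auto simp: computable_def rec1_enc_dec)

lemma computable_rec2:
  "rec2 f \<Longrightarrow> computable g \<Longrightarrow> computable h \<Longrightarrow> computable (\<lambda>x. f (g x) (h x))"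
  using rec1_app2[of f "\<lambda>n. enc (g (dec n))" "\<lambda>n. enc (h (dec n))"] by (simp add: computable_def)

lemmas computable_add [computable] = computable_rec2[OF rec2_add]
lemmas computable_diff [computable] = computable_rec2[OF rec2_diff]

lemma computable_Suc [computable]: "computable f \<Longrightarrow> computable (\<lambda>x. Suc (f x))"
  using computable_add[of f "\<lambda>x. 1"] by (simp add: computable_const)

lemma computable_prod_encode [computable]: "computable f \<Longrightarrow> computable (\<lambda>x. prod_encode (f x))"
  by (rule computable_compose[of prod_encode])
    (auto simp: computable_def dec_prod_def rec1_id)

lemma computable_prod_decode [computable]: "computable f \<Longrightarrow> computable (\<lambda>x. prod_decode (f x))"
  by (rule computable_compose[of prod_decode])
    (auto simp: computable_def enc_prod_def rec1_id)

lemma computable_If [computable]: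
  assumes "computable b" "computable f" "computable g"
  shows "computable (\<lambda>x. if b x then f x else g x)"
proof -
  \<comment> \<open>The condition has code 0 or 1, so a recursion of that length selects the
    branch.\<close>
  have "computable (\<lambda>x. rec_nat (g x) (\<lambda>k r. f x) (enc (b x)))"
    by (intro computable_rec_nat computable_enc assms computable_fst computable_compose[of f fst]) 
      (rule computable)
  then show ?thesis
    by (rule back_subst[of computable]) (auto simp: enc_bool_def)
qed

lemma computable_le_nat [computable]:
  fixes f g :: "'a::enc \<Rightarrow> nat"
  assumes "computable f" "computable g"
  shows "computable (\<lambda>x. f x \<le> g x)"
proof -
  have "computable (\<lambda>x. dec (1 - (f x - g x)) :: bool)"
    by (intro computable assms)
  then show ?thesis
    by (rule back_subst[of computable]) (auto simp: dec_bool_def)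
qed

lemma computable_conj [computable]:
  assumes "computable p" "computable q"
  shows "computable (\<lambda>x. p x \<and> q x)"
proof -
  have "computable (\<lambda>x. if p x then q x else False)"
    by (intro computable assms)
  then show ?thesis
    by (rule back_subst[of computable]) auto
qed

lemma computable_disj [computable]:
  assumes "computable p" "computable q"
  shows "computable (\<lambda>x. p x \<or> q x)"
proof -
  have "computable (\<lambda>x. if p x then True else q x)"
    by (intro computable assms)
  then show ?thesis
    by (rule back_subst[of computable]) auto
qed

lemma computable_Not [computable]:
  assumes "computable p"
  shows "computable (\<lambda>x. \<not> p x)"
proof -
  have "computable (\<lambda>x. if p x then False else True)"
    by (intro computable assms)
  then show ?thesis
    by (rule back_subst[of computable]) auto
qed

text \<open>\<open>enc\<close> is injective, so equality can be tested on the codes.\<close>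

lemma computable_eq [computable]:
  assumes "computable f" "computable g"
  shows "computable (\<lambda>x. f x = g x)"
proof -
  have "computable (\<lambda>x. enc (f x) \<le> enc (g x) \<and> enc (g x) \<le> enc (f x))"
    by (intro computable assms)
  then show ?thesis
    by (simp flip: eq_iff)
qed

lemma computable_funpow [computable]:
  fixes f :: "'a::enc \<Rightarrow> 'b::enc \<Rightarrow> 'b"
  assumes "computable (\<lambda>z. f (fst z) (snd z))" "computable n" "computable i"
  shows "computable (\<lambda>x. (f x ^^ n x) (i x))"
proof -
  have "computable (\<lambda>x. rec_nat (i x) (\<lambda>k r. f x r) (n x))"
    by (intro computable_rec_nat assms computable_split[OF assms(1)] computable)
  moreover have "rec_nat a (\<lambda>k r. h r) m = (h ^^ m) a" for h :: "'b \<Rightarrow> 'b" and a m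
    by (induction m) auto
  ultimately show ?thesis
    by simp
qed

section \<open>Lists\<close>

lemma length_list_decode_le: "length (list_decode n) \<le> n"
proof (induction n rule: list_decode.induct)
  case (2 n)
  have "snd (prod_decode n) \<le> n"
    by (metis le_prod_encode_2 prod.collapse prod_decode_inverse)
  then show ?case
    using 2 by (auto split: prod.split)
qed simp

text \<open>Stated for codes because lists are not yet an instance of \<open>enc\<close>: their
  normalisation is itself computed by folding.\<close>

lemma computable_fold_list_decode:
  assumes F: "computable (\<lambda>z. F (fst z) (fst (snd z)) (snd (snd z)))"
    and c: "computable c" and i: "computable i"
  shows "computable (\<lambda>x. fold (F x) (map dec (list_decode (c x))) (i x))"
proof -
  \<comment> \<open>The state is the code of the remaining list with the accumulator. Code 0 is the
    empty list, on which the step rests; otherwise the predecessor of the code is the pair of head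
    and tail.\<close>
  define step where "step x s =
    (if fst s = 0 then s
     else (snd (prod_decode (fst s - 1)), F x (dec (fst (prod_decode (fst s - 1)))) (snd s)))" for x s
  have F': "computable (\<lambda>x. F (f x) (g x) (h x))"
    if "computable f" "computable g" "computable h"
    for f :: "'d::enc \<Rightarrow> 'a" and g h
    using computable_compose[OF F, of "\<lambda>x. (f x, g x, h x)"] that by (simp add: computable)
  \<comment> \<open>A list is no longer than its code, so the code itself serves as the number of
    iterations.\<close>
  have "computable (\<lambda>x. snd ((step x ^^ c x) (c x, i x)))"
    unfolding step_def by (intro computable F' c i)
  moreover have "snd ((step x ^^ m) (n, a)) = fold (F x) (map dec (list_decode n)) a"
    if "length (list_decode n) \<le> m" for x m n a
    using that
  proof (induction m arbitrary: n a)
    case 0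
    then show ?case
      by (cases n) (auto split: prod.splits)
  next
    case (Suc m)
    show ?case
    proof (cases n)
      case 0
      have "(step x ^^ k) (0, a) = (0, a)" for k
        by (induction k) (auto simp: step_def)
      from this[of "Suc m"] show ?thesis
        using 0 by simp
    next
      case (Suc l)
      then have "step x (n, a) = (snd (prod_decode l), F x (dec (fst (prod_decode l))) a)"
        by (simp add: step_def)
      then show ?thesis
        using Suc.IH[of "snd (prod_decode l)"] Suc.prems Suc
        by (simp add: funpow_swap1 case_prod_beta del: funpow.simps
            add: funpow_Suc_right)
    qed
  qed
  ultimately show ?thesis
    by (simp add: length_list_decode_le)
qed

lemma fold_list_encode:
  "fold (\<lambda>y a. Suc (prod_encode (enc y, a))) ys (list_encode zs) = list_encode (rev (map enc ys) @ zs)"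
  by (induction ys arbitrary: zs) (simp_all flip: list_encode.simps)

instantiation list :: (enc) enc
begin
definition enc_list :: "'a list \<Rightarrow> nat" where "enc_list xs = list_encode (map enc xs)"
definition dec_list :: "nat \<Rightarrow> 'a list" where "dec_list n = map dec (list_decode n)"
instance
proof
  \<comment> \<open>Each fold rebuilds the list in reverse. The inner one normalises the elements,
    the outer one restores the order.\<close>
  have "computable (\<lambda>n. fold (\<lambda>y a. Suc (prod_encode (enc y, a))) 
     (map (dec :: nat \<Rightarrow> nat) (list_decode
       (fold (\<lambda>y a. Suc (prod_encode (enc y, a))) (map (dec :: nat \<Rightarrow> 'a) (list_decode n)) 0))) 0)"
    by (intro computable_fold_list_decode computable)
  moreover have "fold (\<lambda>y a. Suc (prod_encode (y, a))) ys 0 = list_encode (rev ys)" for ys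
    using fold_list_encode[of ys "[]"] by (simp add: map_idI)
  ultimately show "rec1 (\<lambda>n. enc (dec n :: 'a list))"
    by (simp add: computable_def enc_list_def dec_list_def rev_map o_def
        fold_list_encode[where zs = "[]", simplified])
qed (simp add: enc_list_def dec_list_def map_idI)
end

lemma enc_Nil: "enc [] = 0"
  by (simp add: enc_list_def)

lemma enc_Cons: "enc (x # xs) = Suc (prod_encode (enc x, enc xs))"
  by (simp add: enc_list_def)

lemma computable_fold [computable]:
  assumes "computable (\<lambda>z. F (fst z) (fst (snd z)) (snd (snd z)))" "computable xs" "computable i"
  shows "computable (\<lambda>x. fold (F x) (xs x) (i x))"
proof -
  have "computable (\<lambda>x. fold (F x) (map dec (list_decode (enc (xs x)))) (i x))"
    by (intro computable_fold_list_decode assms computable)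
  then show ?thesis
    by (simp flip: dec_list_def)
qed

lemma computable_Cons [computable]:
  assumes "computable f" "computable g"
  shows "computable (\<lambda>x. f x # g x)"
proof -
  have "computable (\<lambda>x. dec (Suc (prod_encode (enc (f x), enc (g x)))) :: 'b list)"
    by (intro computable assms)
  then show ?thesis
    by (simp flip: enc_Cons)
qed

lemma computable_case_list [computable]:
  fixes g :: "'a::enc \<Rightarrow> 'b::enc \<Rightarrow> 'b list \<Rightarrow> 'c::enc"
  assumes f: "computable f" and g: "computable (\<lambda>z. g (fst z) (fst (snd z)) (snd (snd z)))"
    and xs: "computable xs"
  shows "computable (\<lambda>x. case xs x of [] \<Rightarrow> f x | y # ys \<Rightarrow> g x y ys)"
proof -
  \<comment> \<open>Head and tail of a nonempty list; for the empty list the value is arbitrary and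
    the test below discards it.\<close>
  define h where "h x = (dec (enc (xs x) - 1) :: 'b \<times> 'b list)" for x
  have h: "computable h"
    unfolding h_def by (intro computable xs)
  have "computable (\<lambda>x. (\<lambda>z. g (fst z) (fst (snd z)) (snd (snd z))) (x, h x))"
    by (rule computable_compose[OF g]) (intro computable h)
  then have "computable (\<lambda>x. if enc (xs x) = 0 then f x else g x (fst (h x)) (snd (h x)))"
    by (intro computable f xs) simp
  then show ?thesis
    by (rule back_subst[of computable])
      (auto simp: h_def enc_Nil enc_Cons dec_prod_def fun_eq_iff split: list.split)
qed

lemma computable_rev [computable]:
  assumes "computable xs"
  shows "computable (\<lambda>x. rev (xs x))"
proof -
  have "computable (\<lambda>x. fold (\<lambda>y ys. y # ys) (xs x) [])"
    by (intro computable assms)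
  then show ?thesis
    by (simp add: fold_Cons_rev)
qed

lemma computable_foldr [computable]:
  assumes "computable (\<lambda>z. F (fst z) (fst (snd z)) (snd (snd z)))" "computable xs" "computable i"
  shows "computable (\<lambda>x. foldr (F x) (xs x) (i x))"
  unfolding foldr_conv_fold by (intro computable assms)

lemma computable_append [computable]:
  assumes "computable f" "computable g"
  shows "computable (\<lambda>x. f x @ g x)"
proof -
  have "computable (\<lambda>x. foldr (\<lambda>y ys. y # ys) (f x) (g x))"
    by (intro computable assms)
  moreover have "foldr (\<lambda>y ys. y # ys) xs zs = xs @ zs" for xs zs :: "'b list"
    by (induction xs) auto
  ultimately show ?thesis
    by simp
qed

lemma computable_map [computable]:
  assumes f: "computable (\<lambda>z. f (fst z) (snd z))" and "computable xs"
  shows "computable (\<lambda>x. map (f x) (xs x))"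
proof -
  have "computable (\<lambda>x. foldr (\<lambda>y ys. f x y # ys) (xs x) [])"
    by (intro computable assms computable_split[OF f])
  moreover have "foldr (\<lambda>y ys. h y # ys) zs [] = map h zs" for zs and h :: "'b \<Rightarrow> 'c"
    by (induction zs) auto
  ultimately show ?thesis
    by simp
qed

lemma computable_concat [computable]:
  assumes "computable xs"
  shows "computable (\<lambda>x. concat (xs x))"
  unfolding concat_conv_foldr by (intro computable assms)

lemma computable_filter [computable]:
  assumes f: "computable (\<lambda>z. f (fst z) (snd z))" and "computable xs"
  shows "computable (\<lambda>x. filter (f x) (xs x))"
proof -
  have "computable (\<lambda>x. foldr (\<lambda>y ys. if f x y then y # ys else ys) (xs x) [])"
    by (intro computable assms computable_split[OF f])
  moreover have "foldr (\<lambda>y ys. if h y then y # ys else ys) zs [] = filter h zs"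
    for zs and h :: "'b \<Rightarrow> bool"
    by (induction zs) auto
  ultimately show ?thesis
    by simp
qed

lemma computable_Ball_set [computable]:
  assumes f: "computable (\<lambda>z. f (fst z) (snd z))" and "computable xs"
  shows "computable (\<lambda>x. \<forall>y\<in>set (xs x). f x y)"
proof -
  have "computable (\<lambda>x. filter (\<lambda>y. \<not> f x y) (xs x) = [])"
    by (intro computable assms computable_split[OF f])
  then show ?thesis
    by (simp add: filter_empty_conv)
qed

lemma computable_Bex_set [computable]:
  assumes f: "computable (\<lambda>z. f (fst z) (snd z))" and "computable xs"
  shows "computable (\<lambda>x. \<exists>y\<in>set (xs x). f x y)"
proof -
  have "computable (\<lambda>x. filter (\<lambda>y. f x y) (xs x) \<noteq> [])"
    by (intro computable assms computable_split[OF f])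
  then show ?thesis
    by (simp add: filter_empty_conv)
qed

lemma computable_tl [computable]:
  assumes "computable xs"
  shows "computable (\<lambda>x. tl (xs x))"
  unfolding tl_def by (intro computable assms)

lemma computable_upt [computable]:
  assumes "computable n"
  shows "computable (\<lambda>x. [0..<n x])"
proof -
  have "computable (\<lambda>x. rec_nat [] (\<lambda>k r. r @ [k]) (n x))"
    by (intro computable assms)
  moreover have "rec_nat [] (\<lambda>k r. r @ [k]) m = [0..<m]" for m
    by (induction m) auto
  ultimately show ?thesis
    by simp
qed

text \<open>\<open>!\<close> is underspecified beyond the end of a list, hence the default. The
  entry is the head of an iterated tail.\<close>

lemma computable_nth [computable]:
  assumes "computable xs" "computable n" "computable d"
  shows "computable (\<lambda>x. if n x < length (xs x) then xs x ! n x else d x)"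
proof -
  have "computable (\<lambda>x. case (tl ^^ n x) (xs x) of [] \<Rightarrow> d x | y # ys \<Rightarrow> y)"
    by (intro computable assms)
  moreover have "(tl ^^ m) ys = drop m ys" for m and ys :: "'b list"
    by (induction m) (auto simp: drop_Suc tl_drop)
  moreover have "(case drop m ys of [] \<Rightarrow> e | y # _ \<Rightarrow> y) = (if m < length ys then ys ! m else e)"
    for m ys and e :: 'b
    by (cases "m < length ys") (auto simp flip: Cons_nth_drop_Suc)
  ultimately show ?thesis
    by simp
qed

instantiation option :: (enc) enc
begin
definition enc_option :: "'a option \<Rightarrow> nat" where
  "enc_option p = (case p of None \<Rightarrow> 0 | Some a \<Rightarrow> Suc (enc a))"
definition dec_option :: "nat \<Rightarrow> 'a option" where
  "dec_option n = (if n = 0 then None else Some (dec (n - 1)))"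
instance
proof
  have "computable (\<lambda>n. if n = 0 then 0 else Suc (enc (dec (n - 1) :: 'a)))"
    by (intro computable)
  moreover have "enc (dec n :: 'a option) = (if n = 0 then 0 else Suc (enc (dec (n - 1) :: 'a)))" for n
    by (simp add: enc_option_def dec_option_def)
  ultimately show "rec1 (\<lambda>n. enc (dec n :: 'a option))"
    by (simp add: computable_def cong: if_cong)
qed (auto simp: enc_option_def dec_option_def split: option.split)
end

lemma computable_Some [computable]:
  assumes "computable f"
  shows "computable (\<lambda>x. Some (f x))"
proof -
  have "computable (\<lambda>x. dec (Suc (enc (f x))) :: 'b option)"
    by (intro computable assms)
  then show ?thesis
    by (simp add: dec_option_def)
qed

lemma computable_case_option [computable]:
  assumes f: "computable f" and g: "computable (\<lambda>z. g (fst z) (snd z))" and p: "computable p"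
  shows "computable (\<lambda>x. case p x of None \<Rightarrow> f x | Some a \<Rightarrow> g x a)"
proof -
  have "computable (\<lambda>x. if p x = None then f x else g x (dec (enc (p x) - 1)))"
    by (intro computable f p computable_split[OF g])
  then show ?thesis
    by (rule back_subst[of computable]) (auto simp: enc_option_def split: option.split)
qed

lemma computable_map_of [computable]:
  assumes "computable xs" "computable k"
  shows "computable (\<lambda>x. map_of (xs x) (k x))"
proof -
  have "computable (\<lambda>x. foldr (\<lambda>e r. if fst e = k x then Some (snd e) else r) (xs x) None)"
    by (intro computable assms computable_compose[OF assms(2)])
  moreover have "foldr (\<lambda>e r. if fst e = a then Some (snd e) else r) ys None = map_of ys a"
    for a and ys :: "('b \<times> 'c) list"
    by (induction ys) auto
  ultimately show ?thesis
    by simp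
qed

section \<open>Binary set codes, integers and vectors\<close>

lemma computable_even [computable]:
  assumes "computable f"
  shows "computable (\<lambda>x. even (f x :: nat))"
proof -
  have "computable (\<lambda>x. rec_nat True (\<lambda>k b. \<not> b) (f x))"
    by (intro computable assms)
  moreover have "rec_nat True (\<lambda>k b. \<not> b) n = even n" for n
    by (induction n) auto
  ultimately show ?thesis
    by simp
qed

lemma computable_div2 [computable]:
  assumes "computable f"
  shows "computable (\<lambda>x. f x div (2 :: nat))"
proof -
  have "computable (\<lambda>x. rec_nat 0 (\<lambda>k r. if even k then r else Suc r) (f x))"
    by (intro computable assms)
  moreover have "rec_nat 0 (\<lambda>k r. if even k then r else Suc r) n = n div 2" for n :: nat
    by (induction n) auto
  ultimately show ?thesis
    by simp
qed

text \<open>The code of a set is its binary mask: an element is tested by the parity after as many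
  halvings.\<close>

lemma computable_mem_set_decode [computable]:
  assumes "computable f" "computable g"
  shows "computable (\<lambda>x. f x \<in> set_decode (g x))"
proof -
  have "computable (\<lambda>x. \<not> even (((\<lambda>n. n div 2) ^^ f x) (g x)))"
    by (intro computable assms)
  moreover have "((\<lambda>n. n div 2) ^^ k) n = n div 2 ^ k" for k and n :: nat
    by (induction k) (auto simp: mult.commute simp flip: div_mult2_eq)
  ultimately show ?thesis
    by (simp add: set_decode_def)
qed

instantiation int :: enc
begin
definition enc_int :: "int \<Rightarrow> nat" where "enc_int = int_encode"
definition dec_int :: "nat \<Rightarrow> int" where "dec_int = int_decode"
instance
  by standard (auto simp: enc_int_def dec_int_def rec1_id)
end

lemma computable_nat [computable]:
  assumes "computable f"
  shows "computable (\<lambda>x. nat (f x))"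
proof -
  have "computable (\<lambda>x. if even (enc (f x)) then enc (f x) div 2 else 0)"
    by (intro computable assms)
  moreover have "(if even (enc i) then enc i div 2 else 0) = nat i" for i :: int
    by (simp add: enc_int_def int_encode_def sum_encode_def)
  ultimately show ?thesis
    by simp
qed

lemma computable_nat_uminus [computable]:
  assumes "computable f"
  shows "computable (\<lambda>x. nat (- f x))"
proof -
  have "computable (\<lambda>x. if even (enc (f x)) then 0 else Suc (enc (f x) div 2))"
    by (intro computable assms)
  moreover have "(if even (enc i) then 0 else Suc (enc i div 2)) = nat (- i)" for i :: int
    by (auto simp: enc_int_def int_encode_def sum_encode_def)
  ultimately show ?thesis
    by simp
qed

lemma computable_add_int [computable]:
  assumes "computable f" "computable g"
  shows "computable (\<lambda>x. f x + g x :: int)"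
proof -
  \<comment> \<open>The integer a - b obtained from its code: i \<ge> 0 has code 2i and -k-1 has
    code 2k+1. A sum of integers is then the difference of the sums of the positive and of the
    negative parts.\<close>
  define h where "h a b = (dec (if b \<le> a then (a - b) + (a - b) else Suc ((b - a - 1) + (b - a - 1))) :: int)"
    for a b :: nat
  have "computable (\<lambda>x. h (nat (f x) + nat (g x)) (nat (- f x) + nat (- g x)))"
    unfolding h_def by (intro computable assms)
  moreover have "h a b = int a - int b" for a b
  proof -
    have "int_encode (int a - int b) =
        (if b \<le> a then (a - b) + (a - b) else Suc ((b - a - 1) + (b - a - 1)))"
      by (auto simp: int_encode_def sum_encode_def nat_diff_distrib' nat_eq_iff)
    then show ?thesis
      using dec_enc[of "int a - int b"] by (simp add: h_def enc_int_def)
  qed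
  moreover have "int (nat i + nat j) - int (nat (- i) + nat (- j)) = i + j" for i j
    by simp
  ultimately show ?thesis
    by simp
qed

instantiation vec :: (enc, finite) enc
begin
definition enc_vec :: "'a ^ 'b \<Rightarrow> nat" where
  "enc_vec v = enc (map (\<lambda>k. v $ inv_into UNIV (to_nat_on (UNIV :: 'b set)) k) [0..<CARD('b)])"
definition dec_vec :: "nat \<Rightarrow> 'a ^ 'b" where
  "dec_vec n = (\<chi> i. let xs = dec n; k = to_nat_on (UNIV :: 'b set) i
                     in if k < length xs then xs ! k else dec 0)"
instance
proof
  let ?t = "to_nat_on (UNIV :: 'b set)"
  have bij: "bij_betw ?t UNIV {..<CARD('b)}"
    by (rule to_nat_on_finite) simp
  then have t: "?t i < CARD('b)" "inv_into UNIV ?t (?t i) = i" for i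
    by (auto simp: bij_betw_def)
  show "dec (enc v) = v" for v :: "'a ^ 'b"
    by (simp add: enc_vec_def dec_vec_def vec_eq_iff t)
  have "computable (\<lambda>n. enc (map (\<lambda>k. if k < length (dec n :: 'a list) then (dec n :: 'a list) ! k else dec 0)
      [0..<CARD('b)]))"
    by (intro computable_enc, rule computable_map, rule computable_nth) (intro computable)+
  moreover have "?t (inv_into UNIV ?t k) = k" if "k < CARD('b)" for k
    using bij_betw_inv_into_right[OF bij] that by auto
  then have "enc (dec n :: 'a ^ 'b) =
      enc (map (\<lambda>k. if k < length (dec n :: 'a list) then (dec n :: 'a list) ! k else dec 0) [0..<CARD('b)])" for n
    by (auto simp: enc_vec_def dec_vec_def cong: map_cong)
  ultimately show "rec1 (\<lambda>n. enc (dec n :: 'a ^ 'b))"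
    by (simp add: computable_def cong: if_cong)
qed
end

lemma computable_vec_nth [computable]:
  fixes f :: "'a::enc \<Rightarrow> 'b::enc ^ 'c::finite"
  assumes "computable f"
  shows "computable (\<lambda>x. f x $ i)"
proof -
  let ?xs = "\<lambda>x. dec (enc (f x)) :: 'b list" and ?k = "to_nat_on (UNIV :: 'c set) i"
  have "computable (\<lambda>x. if ?k < length (?xs x) then ?xs x ! ?k else dec 0)"
    by (rule computable_nth; intro computable assms)
  moreover have "(dec (enc (f x)) :: 'b ^ 'c) $ i = (if ?k < length (?xs x) then ?xs x ! ?k else dec 0)" for x
    by (simp add: dec_vec_def Let_def del: dec_enc)
  ultimately show ?thesis
    by simp
qed

text \<open>The coordinates form a fixed finite set, so each may be computed by a function of its
  own, without uniformity in \<open>i\<close>; the list of values is assembled by induction over a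
  constant list of indices.\<close>

lemma computable_vec_lambda [computable]:
  fixes f :: "'a::enc \<Rightarrow> 'c::finite \<Rightarrow> 'b::enc"
  assumes f: "\<And>i. computable (\<lambda>x. f x i)"
  shows "computable (\<lambda>x. \<chi> i. f x i)"
proof -
  let ?g = "\<lambda>x k. f x (inv_into UNIV (to_nat_on (UNIV :: 'c set)) k)"
  have "computable (\<lambda>x. map (?g x) ks)" for ks
  proof (induction ks)
    case Nil
    show ?case
      by (simp add: computable_const)
  next
    case (Cons k ks)
    then show ?case
      unfolding list.map by (intro computable_Cons f)
  qed
  then have "computable (\<lambda>x. dec (enc (map (?g x) [0..<CARD('c)])) :: 'b ^ 'c)"
    by (intro computable_dec computable_enc)
  moreover have "enc (map (?g x) [0..<CARD('c)]) = enc (\<chi> i. f x i)" for x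
    by (simp add: enc_vec_def)
  ultimately show ?thesis
    by simp
qed

lemma computable_add_vec [computable]:
  assumes "computable f" "computable g"
  shows "computable (\<lambda>x. f x + g x :: int ^ 'd::finite)"
  unfolding plus_vec_def by (intro computable assms)

text \<open>The vector instance numbers and pads coordinates so that this holds; pattern codes then
  need no translation.\<close>

lemma vec_decode_eq_dec: "vec_decode = dec"
  by (simp add: fun_eq_iff vec_decode_def dec_vec_def dec_list_def dec_int_def vec_eq_iff Let_def
      int_decode_def sum_decode_def)

instantiation move :: enc
begin
definition enc_move :: "move \<Rightarrow> nat" where "enc_move = move_encode"
definition dec_move :: "nat \<Rightarrow> move" where "dec_move n = (if n = 0 then MoveL else MoveR)"
instance
proof
  show "dec (enc a) = a" for a :: move
    by (cases a) (auto simp: enc_move_def dec_move_def)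
  have "computable (\<lambda>n :: nat. if n = 0 then 0 else 1 :: nat)"
    by (intro computable)
  moreover have "enc (dec n :: move) = (if n = 0 then 0 else 1)" for n
    by (simp add: enc_move_def dec_move_def)
  ultimately show "rec1 (\<lambda>n. enc (dec n :: move))"
    by (simp add: computable_def)
qed
end

section \<open>Semidecidable predicates\<close>

definition semicomputable :: "('a::enc \<Rightarrow> bool) \<Rightarrow> bool" where
  "semicomputable P \<longleftrightarrow>
    (\<exists>R :: 'a \<Rightarrow> nat \<Rightarrow> bool. computable (\<lambda>z. R (fst z) (snd z)) \<and> (\<forall>x. P x \<longleftrightarrow> (\<exists>n. R x n)))"

lemma semicomputableI:
  "computable (\<lambda>z. R (fst z) (snd z :: nat)) \<Longrightarrow> (\<And>x. P x \<longleftrightarrow> (\<exists>n. R x n)) \<Longrightarrow> semicomputable P"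
  unfolding semicomputable_def by blast

lemma semicomputableE:
  assumes "semicomputable P"
  obtains R :: "'a::enc \<Rightarrow> nat \<Rightarrow> bool" where
    "computable (\<lambda>z. R (fst z) (snd z :: nat))"
    "\<And>x. P x \<longleftrightarrow> (\<exists>n. R x n)"
  using assms unfolding semicomputable_def by blast

lemma semicomputable_computable:
  assumes "computable P"
  shows "semicomputable P"
  by (rule semicomputableI[of "\<lambda>x n. P x"])
    (intro computable_compose[OF assms] computable_fst computable_id, simp)

lemma semicomputable_compose:
  assumes "semicomputable P" "computable f"
  shows "semicomputable (\<lambda>x. P (f x))"
  using assms(1)
proof (rule semicomputableE)
  fix R
  assume R: "computable (\<lambda>z. R (fst z) (snd z :: nat))" and P: "\<And>x. P x \<longleftrightarrow> (\<exists>n. R x n)"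
  have "computable (\<lambda>z. R (f (fst z)) (snd z :: nat))"
    by (intro computable_split[OF R] computable_compose[OF assms(2)] computable_fst computable_snd computable_id)
  then show ?thesis
    using P by (intro semicomputableI[of "\<lambda>x. R (f x)"])
qed

lemma semicomputable_conj:
  fixes P Q :: "'a::enc \<Rightarrow> bool"
  assumes "semicomputable P" "semicomputable Q"
  shows "semicomputable (\<lambda>x. P x \<and> Q x)"
proof -
  obtain R :: "'a \<Rightarrow> nat \<Rightarrow> bool" where R: "computable (\<lambda>z. R (fst z) (snd z :: nat))"
    and P: "\<And>x. P x \<longleftrightarrow> (\<exists>n. R x n)"
    using assms(1) unfolding semicomputable_def by blast
  obtain S :: "'a \<Rightarrow> nat \<Rightarrow> bool" where S: "computable (\<lambda>z. S (fst z) (snd z :: nat))"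
    and Q: "\<And>x. Q x \<longleftrightarrow> (\<exists>n. S x n)"
    using assms(2) unfolding semicomputable_def by blast
  show ?thesis
  proof (rule semicomputableI)
    show "computable (\<lambda>z. R (fst z) (fst (prod_decode (snd z))) \<and> S (fst z) (snd (prod_decode (snd z))))"
      by (intro computable computable_split[OF R] computable_split[OF S])
    show "P x \<and> Q x \<longleftrightarrow> (\<exists>n. R x (fst (prod_decode n)) \<and> S x (snd (prod_decode n)))" for x
      unfolding P Q by (metis fst_conv snd_conv prod_encode_inverse)
  qed
qed

text \<open>One number carries both \<open>y\<close> and the witness. As \<open>dec\<close> is total
  and onto, searching over numbers meets every \<open>y\<close> and no invalid code.\<close>

lemma semicomputable_Ex:
  fixes P :: "'a::enc \<Rightarrow> 'b::enc \<Rightarrow> bool"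
  assumes "semicomputable (\<lambda>z. P (fst z) (snd z))"
  shows "semicomputable (\<lambda>x. \<exists>y. P x y)"
proof -
  obtain R :: "'a \<times> 'b \<Rightarrow> nat \<Rightarrow> bool" where R: "computable (\<lambda>z. R (fst z) (snd z :: nat))"
    and P: "\<And>x. P (fst x) (snd x) \<longleftrightarrow> (\<exists>n. R x n)"
    using assms unfolding semicomputable_def by blast
  show ?thesis
  proof (rule semicomputableI)
    show "computable (\<lambda>z. R (fst z, dec (fst (prod_decode (snd z)))) (snd (prod_decode (snd z))))"
      by (intro computable computable_split[OF R])
    show "(\<exists>y. P x y) \<longleftrightarrow> (\<exists>n. R (x, dec (fst (prod_decode n))) (snd (prod_decode n)))" for x
    proof
      assume "\<exists>y. P x y"
      then obtain y n where "R (x, y) n"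
        using P[of "(x, _)"] by auto
      then show "\<exists>n. R (x, dec (fst (prod_decode n))) (snd (prod_decode n))"
        by (intro exI[of _ "prod_encode (enc y, n)"]) simp
    qed (use P[of "(x, _)"] in auto)
  qed
qed

text \<open>Finitely many witnesses have a common bound, and the search is for that bound.\<close>

lemma semicomputable_Ball_set:
  fixes P :: "'a::enc \<Rightarrow> 'b::enc \<Rightarrow> bool"
  assumes "semicomputable (\<lambda>z. P (fst z) (snd z))" and xs: "computable xs"
  shows "semicomputable (\<lambda>x. \<forall>y\<in>set (xs x). P x y)"
proof -
  obtain R :: "'a \<times> 'b \<Rightarrow> nat \<Rightarrow> bool" where R: "computable (\<lambda>z. R (fst z) (snd z :: nat))"
    and P: "\<And>x. P (fst x) (snd x) \<longleftrightarrow> (\<exists>n. R x n)"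
    using assms(1) unfolding semicomputable_def by blast
  show ?thesis
  proof (rule semicomputableI)
    show "computable (\<lambda>z. \<forall>y\<in>set (xs (fst z)). \<exists>n\<in>set [0..<snd z]. R (fst z, y) n)"
      by (intro computable computable_split[OF R] computable_compose[OF xs])
    show "(\<forall>y\<in>set (xs x). P x y) \<longleftrightarrow> (\<exists>m. \<forall>y\<in>set (xs x). \<exists>n\<in>set [0..<m]. R (x, y) n)" for x
    proof
      assume "\<forall>y\<in>set (xs x). P x y"
      then obtain f where f: "\<And>y. y \<in> set (xs x) \<Longrightarrow> R (x, y) (f y)"
        using P[of "(x, _)"] by auto metis
      have "f y < Suc (Max (f ` set (xs x)))" if "y \<in> set (xs x)" for y
        using that by (simp add: less_Suc_eq_le)
      with f show "\<exists>m. \<forall>y\<in>set (xs x). \<exists>n\<in>set [0..<m]. R (x, y) n"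
        by (metis atLeastLessThan_iff set_upt zero_le)
    qed (use P[of "(x, _)"] in auto)
  qed
qed

lemma Sigma01_semicomputable:
  assumes "semicomputable P"
  shows "Sigma01 {n :: nat. P n}"
proof -
  obtain R :: "nat \<Rightarrow> nat \<Rightarrow> bool" where R: "computable (\<lambda>z. R (fst z) (snd z :: nat))"
    and P: "\<And>x. P x \<longleftrightarrow> (\<exists>n. R x n)"
    using assms unfolding semicomputable_def by blast
  have "computable (\<lambda>n. enc (R (fst (prod_decode n)) (snd (prod_decode n))))"
    by (intro computable computable_split[OF R])
  then have rec: "rec1 (\<lambda>n. enc (R (fst (prod_decode n)) (snd (prod_decode n))))"
    by (simp add: computable_def)
  \<comment> \<open>\<open>rec1\<close> provides a unary function of pairs; composing with the
    pairing function gives the binary one that \<open>recursive_rel\<close> asks for.\<close>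
  have "recursive_on 2 (\<lambda>xs. enc (R (fst (prod_decode (prod_encode (xs ! 0, xs ! 1))))
      (snd (prod_decode (prod_encode (xs ! 0, xs ! 1))))))"
    by (intro recursive_on_app1[OF rec] recursive_on_app2[OF rec2_prod_encode] recursive_on_nth) simp_all
  then obtain f where f: "recursive_fun 2 f" "\<And>xs. length xs = 2 \<Longrightarrow> f xs = enc (R (xs ! 0) (xs ! 1))"
    unfolding recursive_on_def by auto
  have "recursive_rel R"
    unfolding recursive_rel_def using f by (intro exI[of _ f]) (simp add: enc_bool_def)
  then show ?thesis
    unfolding Sigma01_def using P by auto
qed

section \<open>Simulation of Turing machines\<close>

text \<open>The instances for products, lists and moves are chosen to agree with the given coding,
  so that machines can be treated as data of a coded type.\<close>

lemma tm_encode_eq_enc: "tm_encode M = enc M"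
proof -
  have "entry_encode = enc"
    by (auto simp: fun_eq_iff enc_prod_def enc_move_def)
  then show ?thesis
    by (simp add: tm_encode_def enc_list_def)
qed

lemma computable_first_cell [computable]: "computable f \<Longrightarrow> computable (\<lambda>x. first_cell (f x))"
  unfolding first_cell_def by (intro computable)

text \<open>Form without pattern matching on tuples and moves, to which the computability rules
  apply.\<close>

lemma tm_step_eq:
  "tm_step M c = (case map_of M (fst c, first_cell (snd (snd c))) of
     None \<Rightarrow> None
   | Some t \<Rightarrow> if fst (snd t) = MoveL
       then Some (snd (snd t), tl (fst (snd c)), first_cell (fst (snd c)) # fst t # tl (snd (snd c)))
       else Some (snd (snd t), fst t # fst (snd c), tl (snd (snd c))))"
  by (cases c) (auto split: option.split move.split)

lemma computable_tm_step [computable]: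
  assumes "computable M" "computable c"
  shows "computable (\<lambda>x. tm_step (M x) (c x))"
proof -
  have "computable (\<lambda>z :: tm \<times> tm_config. tm_step (fst z) (snd z))"
    unfolding tm_step_eq by (intro computable)
  then show ?thesis
    using assms by (rule computable_split)
qed

text \<open>A halted machine keeps its last configuration, so the run is total in \<open>k\<close>
  and is a plain iteration.\<close>

definition tm_run :: "tm \<Rightarrow> nat \<Rightarrow> tm_config \<Rightarrow> tm_config" where
  "tm_run M k c = ((\<lambda>c. case tm_step M c of None \<Rightarrow> c | Some c' \<Rightarrow> c') ^^ k) c"

lemma tm_outputs_iff_run:
  "tm_outputs M n m \<longleftrightarrow>
    (\<exists>k. tm_step M (tm_run M k (tm_init n)) = None \<and> tm_result (tm_run M k (tm_init n)) = m)"
proof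
  have "\<exists>k. c' = tm_run M k c" if "(\<lambda>c c'. tm_step M c = Some c')\<^sup>*\<^sup>* c c'" for c c'
    using that
  proof (induction rule: rtranclp_induct)
    case base
    show ?case
      by (rule exI[of _ 0]) (simp add: tm_run_def)
  next
    case (step c' c'')
    then obtain k where "c' = tm_run M k c"
      by blast
    with step show ?case
      by (intro exI[of _ "Suc k"]) (simp add: tm_run_def)
  qed
  then show "tm_outputs M n m \<Longrightarrow>
      \<exists>k. tm_step M (tm_run M k (tm_init n)) = None \<and> tm_result (tm_run M k (tm_init n)) = m"
    unfolding tm_outputs_def by metis
next
  have "(\<lambda>c c'. tm_step M c = Some c')\<^sup>*\<^sup>* c (tm_run M k c)" for k c
  proof (induction k)
    case (Suc k)
    then show ?case
      by (auto simp: tm_run_def split: option.split intro: rtranclp.rtrancl_into_rtrancl)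
  qed (simp add: tm_run_def)
  then show "\<exists>k. tm_step M (tm_run M k (tm_init n)) = None \<and> tm_result (tm_run M k (tm_init n)) = m \<Longrightarrow>
      tm_outputs M n m"
    unfolding tm_outputs_def by metis
qed

lemma semicomputable_tm_outputs:
  "semicomputable (\<lambda>z. tm_outputs (fst z) (fst (snd z)) (snd (snd z)))"
proof -
  have count: "computable (\<lambda>x. count_list (f x) (1 :: nat))" if "computable f" for f :: "'x::enc \<Rightarrow> nat list"
  proof -
    have "computable (\<lambda>x. fold (\<lambda>y n. if y = 1 then Suc n else n) (f x) 0)"
      by (intro computable that)
    moreover have "fold (\<lambda>y n. if y = 1 then Suc n else n) ys m = m + count_list ys 1"
      for ys :: "nat list" and m
      by (induction ys arbitrary: m) auto
    ultimately show ?thesis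
      by simp
  qed
  have result: "computable (\<lambda>x. tm_result (f x))" if "computable f" for f :: "'x::enc \<Rightarrow> tm_config"
  proof -
    have "tm_result c = count_list (fst (snd c)) 1 + count_list (snd (snd c)) 1" for c
      by (cases c) simp
    then show ?thesis
      using computable_add[OF count[OF computable_fst[OF computable_snd[OF that]]]
          count[OF computable_snd[OF computable_snd[OF that]]]]
      by simp
  qed
  have init: "computable (\<lambda>x. tm_init (f x))" if "computable f" for f :: "'x::enc \<Rightarrow> nat"
  proof -
    have "replicate (Suc n) (1 :: nat) = rec_nat [1] (\<lambda>k r. 1 # r) n" for n :: nat
      by (induction n) auto
    moreover have "computable (\<lambda>x. (0 :: nat, [] :: nat list, rec_nat [1 :: nat] (\<lambda>k r. 1 # r) (f x)))"
      by (intro computable that)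
    ultimately show ?thesis
      by (simp only: tm_init_def)
  qed
  have "semicomputable (\<lambda>z. \<exists>k.
      tm_step (fst z) (tm_run (fst z) k (tm_init (fst (snd z)))) = None \<and>
      tm_result (tm_run (fst z) k (tm_init (fst (snd z)))) = snd (snd z))"
    unfolding tm_run_def by (intro semicomputable_Ex semicomputable_computable computable result init)
  then show ?thesis
    unfolding tm_outputs_iff_run .
qed

section \<open>Local maps and compactness\<close>

lemma shift_apply: "shift u x v = x (v + u)"
  by (simp add: shift_def)

lemma shift_shift: "shift u (shift v x) = shift (u + v) x"
  by (simp add: shift_def add_ac)

lemma full_shift_iff: "x \<in> full_shift A \<longleftrightarrow> (\<forall>v. x v \<in> A)"
  by (auto simp: full_shift_def)

lemma shift_full_shift: "x \<in> full_shift A \<Longrightarrow> shift u x \<in> full_shift A"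
  by (auto simp: full_shift_def shift_def)

lemma appears_shift: "appears p (shift u x) \<longleftrightarrow> appears p x"
proof -
  have "appears p (shift u x)" if "appears p x" for x :: "'a config" and u
  proof -
    from that obtain v where "\<forall>w\<in>dom p. p w = Some (shift v x w)"
      by (auto simp: appears_def)
    then show ?thesis
      unfolding appears_def by (intro exI[of _ "v - u"]) (simp add: shift_shift)
  qed
  from this[of x u] this[of "shift u x" "- u"] show ?thesis
    by (auto simp: shift_shift shift_def)
qed

lemma shift_avoiding: "x \<in> avoiding A F \<Longrightarrow> shift u x \<in> avoiding A F"
  by (simp add: avoiding_def shift_full_shift appears_shift)

lemma avoiding_mono: "F \<subseteq> F' \<Longrightarrow> avoiding A F' \<subseteq> avoiding A F"
  by (auto simp: avoiding_def)

text \<open>Cylinder conditions. SFTs over a finite alphabet are the sets given by one local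
  predicate at all translates; unlike sets of forbidden patterns, local predicates are directly
  closed under conjunction and under preimages by block codes.\<close>

definition local_pred :: "('d::finite config \<Rightarrow> bool) \<Rightarrow> bool" where
  "local_pred G \<longleftrightarrow> (\<exists>D. finite D \<and> (\<forall>x y. (\<forall>v\<in>D. x v = y v) \<longrightarrow> G x \<longrightarrow> G y))"

text \<open>A block code, given by its window and its table; local configurations missing in the table
  are sent to 0.\<close>

type_synonym 'd rule = "(int ^ 'd) list \<times> (nat list \<times> nat) list"

definition local_map :: "'d::finite rule \<Rightarrow> 'd config \<Rightarrow> 'd config" where
  "local_map r x = (\<lambda>v. case map_of (snd r) (map (\<lambda>w. x (v + w)) (fst r)) of None \<Rightarrow> 0 | Some b \<Rightarrow> b)"

lemma local_map_shift: "local_map r (shift u x) = shift u (local_map r x)"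
  by (simp add: local_map_def shift_def add_ac)

lemma local_map_cong:
  "(\<And>w. w \<in> set (fst r) \<Longrightarrow> x (v + w) = y (v + w)) \<Longrightarrow> local_map r x v = local_map r y v"
  by (simp add: local_map_def cong: map_cong)

lemma local_pred_finite:
  assumes "finite D" "\<And>x y. (\<And>v. v \<in> D \<Longrightarrow> x v = y v) \<Longrightarrow> G x \<Longrightarrow> G y"
  shows "local_pred G"
  using assms unfolding local_pred_def by blast

lemma local_pred_conj:
  assumes "local_pred G" "local_pred H"
  shows "local_pred (\<lambda>x. G x \<and> H x)"
proof -
  obtain D where "finite D" "\<And>x y. (\<forall>v\<in>D. x v = y v) \<Longrightarrow> G x \<Longrightarrow> G y"
    using assms(1) unfolding local_pred_def by blast
  moreover obtain E where "finite E" "\<And>x y. (\<forall>v\<in>E. x v = y v) \<Longrightarrow> H x \<Longrightarrow> H y"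
    using assms(2) unfolding local_pred_def by blast
  ultimately show ?thesis
    by (intro local_pred_finite[of "D \<union> E"]) blast+
qed

lemma local_pred_local_map:
  assumes "local_pred G"
  shows "local_pred (\<lambda>x. G (local_map r x))"
proof -
  obtain D where D: "finite D" "\<And>x y. (\<forall>v\<in>D. x v = y v) \<Longrightarrow> G x \<Longrightarrow> G y"
    using assms unfolding local_pred_def by blast
  show ?thesis
  proof (rule local_pred_finite)
    show "finite (\<Union>v\<in>D. (+) v ` set (fst r))"
      using D(1) by blast
    fix x y assume eq: "\<And>v. v \<in> (\<Union>v\<in>D. (+) v ` set (fst r)) \<Longrightarrow> x v = y v" and G: "G (local_map r x)"
    have "local_map r x v = local_map r y v" if "v \<in> D" for v
      by (rule local_map_cong, rule eq) (use that in blast)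
    then show "G (local_map r y)"
      using D(2) G by blast
  qed
qed

lemma local_pred_coord: "local_pred (\<lambda>x. Q (x v))"
  by (rule local_pred_finite[of "{v}"]) auto

lemma local_pred_fixed: "local_pred (\<lambda>x. local_map r (local_map s x) v = x v)"
proof (rule local_pred_finite)
  let ?D = "insert v (\<Union>w\<in>set (fst r). (+) (v + w) ` set (fst s))"
  show "finite ?D"
    by blast
  show "local_map r (local_map s y) v = y v"
    if "\<And>u. u \<in> ?D \<Longrightarrow> x u = y u" "local_map r (local_map s x) v = x v" for x y
  proof -
    have "local_map r (local_map s x) v = local_map r (local_map s y) v"
      by (intro local_map_cong that(1)) blast
    then show ?thesis
      using that by simp
  qed
qed

text \<open>It suffices to forbid, on the window \<open>D\<close>, the restrictions of
  configurations where \<open>G\<close> fails; over a finite alphabet there are finitely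
  many.\<close>

lemma is_SFT_local_pred:
  assumes "finite A" "local_pred G"
  shows "is_SFT {x \<in> full_shift A. \<forall>u. G (shift u x)}"
proof -
  obtain D where D: "finite D" "\<And>x y. (\<forall>v\<in>D. x v = y v) \<Longrightarrow> G x \<Longrightarrow> G y"
    using assms(2) unfolding local_pred_def by blast
  define F where "F = {p. pattern_over A p \<and> dom p = D \<and> (\<exists>x. \<not> G x \<and> (\<forall>v\<in>D. p v = Some (x v)))}"
  have "finite {p. dom p = D \<and> ran p \<subseteq> A}"
    using assms(1) D(1) by (rule finite_set_of_finite_maps[OF _ _, rotated -1])
  then have "finite F"
    by (rule rev_finite_subset) (auto simp: F_def pattern_over_def)
  moreover have "{x \<in> full_shift A. \<forall>u. G (shift u x)} = avoiding A F"
  proof (intro equalityI subsetI)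
    fix x assume x: "x \<in> {x \<in> full_shift A. \<forall>u. G (shift u x)}"
    have "\<not> appears p x" if p: "p \<in> F" for p
    proof
      assume "appears p x"
      then obtain u where u: "\<forall>v\<in>dom p. p v = Some (shift u x v)"
        by (auto simp: appears_def)
      obtain y where y: "\<not> G y" "\<forall>v\<in>D. p v = Some (y v)"
        using p by (auto simp: F_def)
      have "\<forall>v\<in>D. shift u x v = y v"
        using u y p by (auto simp: F_def)
      then show False
        using D(2)[of "shift u x" y] x y(1) by simp
    qed
    then show "x \<in> avoiding A F"
      using x by (simp add: avoiding_def)
  next
    fix x assume x: "x \<in> avoiding A F"
    have "G (shift u x)" for u
    proof (rule ccontr)
      assume G: "\<not> G (shift u x)"
      let ?p = "\<lambda>v. if v \<in> D then Some (shift u x v) else None"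
      have "dom ?p = D"
        by (auto split: if_splits)
      moreover have "ran ?p \<subseteq> A"
        using x by (auto simp: ran_def avoiding_def full_shift_def shift_def split: if_splits)
      ultimately have "?p \<in> F"
        using D(1) G by (auto simp: F_def pattern_over_def)
      moreover have "appears ?p x"
        unfolding appears_def by (intro exI[of _ u]) (auto split: if_splits)
      ultimately show False
        using x by (auto simp: avoiding_def)
    qed
    then show "x \<in> {x \<in> full_shift A. \<forall>u. G (shift u x)}"
      using x by (simp add: avoiding_def)
  qed
  ultimately show ?thesis
    unfolding is_SFT_def using assms(1) by (auto simp: F_def)
qed

lemma is_SFT_imp_local_pred:
  assumes "is_SFT Y"
  obtains B H where "finite B" "local_pred H" "Y = {x \<in> full_shift B. \<forall>u. H (shift u x)}"
proof -
  obtain B F where F: "finite B" "finite F" "\<forall>p\<in>F. pattern_over B p" "Y = avoiding B F"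
    using assms unfolding is_SFT_def by blast
  define H where "H x \<longleftrightarrow> (\<forall>p\<in>F. \<not> (\<forall>v\<in>dom p. p v = Some (x v)))" for x :: "'a config"
  have "local_pred H"
  proof (rule local_pred_finite)
    show "finite (\<Union>p\<in>F. dom p)"
      using F by (auto simp: pattern_over_def)
    show "H y" if "\<And>v. v \<in> (\<Union>p\<in>F. dom p) \<Longrightarrow> x v = y v" "H x" for x y
      using that unfolding H_def by (metis UN_I)
  qed
  moreover have "Y = {x \<in> full_shift B. \<forall>u. H (shift u x)}"
    unfolding F avoiding_def appears_def H_def by blast
  ultimately show ?thesis
    using that F by blast
qed

lemma is_SFT_imp_is_subshift: "is_SFT X \<Longrightarrow> is_subshift X"
  unfolding is_SFT_def is_subshift_def by blast

text \<open>Every SFT that is not given outright is obtained here: lying in an SFT, being mapped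
  into an SFT by a block code, and being fixed by a composite of block codes are local conditions at
  all translates.\<close>

lemma is_SFT_fixed_points:
  assumes "is_SFT Z" "is_SFT X"
  shows "is_SFT {y \<in> Z. local_map s y \<in> X \<and> local_map r (local_map s y) = y}"
proof -
  obtain A G where G: "finite A" "local_pred G" "X = {x \<in> full_shift A. \<forall>u. G (shift u x)}"
    using assms(2) by (rule is_SFT_imp_local_pred)
  obtain B H where H: "finite B" "local_pred H" "Z = {x \<in> full_shift B. \<forall>u. H (shift u x)}"
    using assms(1) by (rule is_SFT_imp_local_pred)
  \<comment> \<open>All conditions at the origin, including the alphabet condition for
    \<open>local_map s y\<close>. Block codes commute with shifts, so the translates of
    \<open>K\<close> give the conditions everywhere.\<close>
  define K where "K y \<longleftrightarrow> H y \<and> (local_map s y 0 \<in> A \<and> G (local_map s y)) \<and>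
      local_map r (local_map s y) 0 = y 0" for y
  have "local_pred K"
    unfolding K_def
    by (intro local_pred_conj H local_pred_fixed local_pred_local_map[OF G(2)]
        local_pred_local_map[OF local_pred_coord[of "\<lambda>a. a \<in> A" 0]])
  moreover have "{y \<in> Z. local_map s y \<in> X \<and> local_map r (local_map s y) = y} =
      {x \<in> full_shift B. \<forall>u. K (shift u x)}"
    by (simp add: K_def G(3) H(3) full_shift_iff local_map_shift shift_apply fun_eq_iff) blast
  ultimately show ?thesis
    using is_SFT_local_pred[OF H(1)] by simp
qed

section \<open>Cylinders, compactness and block codes\<close>

lemma open_cylinder:
  assumes "finite D"
  shows "open {y :: 'd::finite config. \<forall>v\<in>D. y v = x v}"
proof -
  have "open ((\<lambda>y :: 'd config. y v) -` {x v})" for v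
    by (intro open_vimage open_discrete continuous_on_product_coordinates)
  then have "open (\<Inter>v\<in>D. (\<lambda>y :: 'd config. y v) -` {x v})"
    using assms by blast
  moreover have "(\<Inter>v\<in>D. (\<lambda>y :: 'd config. y v) -` {x v}) = {y. \<forall>v\<in>D. y v = x v}"
    by auto
  ultimately show ?thesis
    by simp
qed

lemma open_local_pred:
  assumes "local_pred G"
  shows "open {x. G x}"
proof -
  obtain D where D: "finite D" "\<And>x y. (\<forall>v\<in>D. x v = y v) \<Longrightarrow> G x \<Longrightarrow> G y"
    using assms unfolding local_pred_def by blast
  show ?thesis
  proof (subst open_subopen, intro ballI)
    fix x assume "x \<in> {x. G x}"
    then have "{y. \<forall>v\<in>D. y v = x v} \<subseteq> {x. G x}"
      using D(2)[of x] eq_commute[of "x _"] by fastforce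
    then show "\<exists>T. open T \<and> x \<in> T \<and> T \<subseteq> {x. G x}"
      using open_cylinder[OF D(1), of x] by (intro exI[of _ "{y. \<forall>v\<in>D. y v = x v}"]) simp
  qed
qed

lemma open_imp_cylinder:
  assumes "open U" "x \<in> U"
  obtains D where "finite D" "{y :: 'd::finite config. \<forall>v\<in>D. y v = x v} \<subseteq> U"
proof -
  have "openin (product_topology (\<lambda>i. euclidean) UNIV) U"
    using assms(1) by (simp add: open_fun_def)
  from product_topology_open_contains_basis[OF this assms(2)]
  obtain T where T: "x \<in> (\<Pi>\<^sub>E i\<in>UNIV. T i)" "finite {i. T i \<noteq> topspace (euclidean :: nat topology)}"
      "(\<Pi>\<^sub>E i\<in>UNIV. T i) \<subseteq> U"
    by blast
  have "{y. \<forall>v\<in>{i. T i \<noteq> UNIV}. y v = x v} \<subseteq> (\<Pi>\<^sub>E i\<in>UNIV. T i)"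
    using T(1) by (auto simp: PiE_iff extensional_def) (metis UNIV_I)
  then show ?thesis
    using T that[of "{i. T i \<noteq> UNIV}"] by auto
qed

lemma continuous_local_map: "continuous_on S (local_map r)"
proof (rule continuous_on_coordinatewise_then_product)
  fix v
  have "open ((\<lambda>x. local_map r x v) -` B)" for B
    using open_local_pred[OF local_pred_local_map[OF local_pred_coord[of "\<lambda>a. a \<in> B" v]]]
    unfolding vimage_def .
  then have "continuous_on UNIV (\<lambda>x. local_map r x v)"
    unfolding continuous_on_open_vimage[OF open_UNIV] Int_UNIV_right by blast
  then show "continuous_on S (\<lambda>x. local_map r x v)"
    by (rule continuous_on_subset) (rule subset_UNIV)
qed

lemma compact_full_shift: "finite A \<Longrightarrow> compact (full_shift A :: 'd::finite config set)"
proof -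
  assume "finite A"
  have "(full_shift A :: 'd config set) = (\<Pi>\<^sub>E i\<in>UNIV. A)"
    by (auto simp: full_shift_def PiE_iff)
  moreover have "compactin (product_topology (\<lambda>i :: int ^ 'd. euclidean :: nat topology) UNIV) (\<Pi>\<^sub>E i\<in>UNIV. A)"
    unfolding compactin_PiE by (simp add: finite_imp_compact \<open>finite A\<close>)
  ultimately show ?thesis
    by (simp add: euclidean_product_topology)
qed

lemma local_pred_occurs:
  assumes "finite (dom p)"
  shows "local_pred (\<lambda>x. \<forall>v\<in>dom p. p v = Some (shift u x v))"
proof (rule local_pred_finite)
  show "finite ((\<lambda>v. v + u) ` dom p)"
    using assms by blast
  fix x y :: "'a config"
  assume eq: "\<And>v. v \<in> (\<lambda>v. v + u) ` dom p \<Longrightarrow> x v = y v"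
  then have "shift u x v = shift u y v" if "v \<in> dom p" for v
    unfolding shift_apply using that by blast
  moreover assume "\<forall>v\<in>dom p. p v = Some (shift u x v)"
  ultimately show "\<forall>v\<in>dom p. p v = Some (shift u y v)"
    by metis
qed

text \<open>The set where \<open>G\<close> holds and the sets where a pattern of \<open>F\<close>
  occurs at a given position are open and cover the compact full shift. A finite subcover bounds the
  patterns and also the positions \<open>U\<close>; the latter bound is what makes certificates
  finite.\<close>

lemma local_pred_compactness:
  assumes A: "finite A" and F: "\<And>p. p \<in> F \<Longrightarrow> finite (dom p)" and G: "local_pred G"
    and avoid: "\<And>x. x \<in> avoiding A F \<Longrightarrow> G x"
  obtains F0 U where "finite F0" "F0 \<subseteq> F" "finite U"
    "\<And>x. x \<in> full_shift A \<Longrightarrow> G x \<or> (\<exists>p\<in>F0. \<exists>u\<in>U. \<forall>v\<in>dom p. p v = Some (shift u x v))"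
proof -
  define C :: "('a pattern \<times> (int ^ 'a)) option \<Rightarrow> 'a config set" where "C i = (case i of None \<Rightarrow> {x. G x}
      | Some (p, u) \<Rightarrow> {x. \<forall>v\<in>dom p. p v = Some (shift u x v)})" for i
  define I :: "('a pattern \<times> (int ^ 'a)) option set" where "I = insert None (Some ` (F \<times> UNIV))"
  have "open (C i)" if "i \<in> I" for i
    using that F by (auto simp: I_def C_def intro!: open_local_pred G local_pred_occurs)
  moreover have "full_shift A \<subseteq> (\<Union>i\<in>I. C i)"
  proof
    fix x :: "'a config" assume "x \<in> full_shift A"
    then show "x \<in> (\<Union>i\<in>I. C i)"
      using avoid[of x] by (auto simp: avoiding_def appears_def I_def C_def split: option.split)
  qed
  ultimately obtain J where J: "J \<subseteq> I" "finite J" "full_shift A \<subseteq> (\<Union>i\<in>J. C i)"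
    using compactE_image[OF compact_full_shift[OF A]] by metis
  define J' where "J' = Some -` J"
  have J': "finite J'" "J' \<subseteq> F \<times> UNIV"
    using J by (auto simp: J'_def I_def intro!: finite_vimageI)
  show ?thesis
  proof (rule that)
    show "finite (fst ` J')" "finite (snd ` J')" "fst ` J' \<subseteq> F"
      using J' by auto
    fix x :: "'a config" assume "x \<in> full_shift A"
    with J(3) obtain i where i: "i \<in> J" "x \<in> C i"
      by blast
    show "G x \<or> (\<exists>p\<in>fst ` J'. \<exists>u\<in>snd ` J'. \<forall>v\<in>dom p. p v = Some (shift u x v))"
    proof (cases i)
      case None
      then show ?thesis
        using i by (simp add: C_def)
    next
      case (Some pu)
      then have "pu \<in> J'" "\<forall>v\<in>dom (fst pu). fst pu v = Some (shift (snd pu) x v)"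
        using i by (auto simp: C_def J'_def case_prod_beta)
      then show ?thesis
        by blast
    qed
  qed
qed

lemma compact_avoiding:
  assumes "finite A" "\<And>p. p \<in> F \<Longrightarrow> finite (dom p)"
  shows "compact (avoiding A F)"
proof -
  have "open {x :: 'a config. appears p x}" if "p \<in> F" for p
  proof -
    have "{x :: 'a config. appears p x} = (\<Union>u. {x. \<forall>v\<in>dom p. p v = Some (shift u x v)})"
      by (auto simp: appears_def)
    then show ?thesis
      using open_local_pred[OF local_pred_occurs[OF assms(2)[OF that]]] by (simp add: open_UN)
  qed
  then have "compact (full_shift A - (\<Union>p\<in>F. {x. appears p x}))"
    by (intro compact_diff compact_full_shift[OF assms(1)] open_UN) blast
  moreover have "full_shift A - (\<Union>p\<in>F. {x. appears p x}) = avoiding A F"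
    by (auto simp: avoiding_def)
  ultimately show ?thesis
    by simp
qed

text \<open>Continuity makes the symbol at 0 of the image depend on finitely many coordinates near
  each point, compactness makes the window uniform, and commutation with shifts carries the
  resulting table to all positions.\<close>

theorem Curtis_Hedlund_Lyndon:
  assumes A: "finite A" and F: "\<And>p. p \<in> F \<Longrightarrow> finite (dom p)"
    and cont: "continuous_on (avoiding A F) \<phi>"
    and equiv: "\<And>u x. x \<in> avoiding A F \<Longrightarrow> \<phi> (shift u x) = shift u (\<phi> x)"
  obtains r where "\<And>x. x \<in> avoiding A F \<Longrightarrow> \<phi> x = local_map r x"
proof -
  let ?X = "avoiding A F"
  define g where "g x = \<phi> x 0" for x
  have "\<exists>D. finite D \<and> (\<forall>y\<in>?X. (\<forall>v\<in>D. y v = x v) \<longrightarrow> g y = g x)" if x: "x \<in> ?X" for x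
  proof -
    have "open {y :: 'a config. \<forall>v\<in>{0}. y v = \<phi> x v}"
      by (rule open_cylinder) simp
    from cont[unfolded continuous_on_open_invariant, rule_format, OF this]
    obtain T where T: "open T" "T \<inter> ?X = \<phi> -` {y. \<forall>v\<in>{0}. y v = \<phi> x v} \<inter> ?X"
      by auto
    then have "x \<in> T"
      using x by auto
    with T(1) obtain D where "finite D" "{y. \<forall>v\<in>D. y v = x v} \<subseteq> T"
      by (rule open_imp_cylinder)
    then show ?thesis
      using T(2) unfolding g_def by (intro exI[of _ D]) fastforce
  qed
  then obtain D where D: "\<And>x. x \<in> ?X \<Longrightarrow> finite (D x)"
      "\<And>x y. x \<in> ?X \<Longrightarrow> y \<in> ?X \<Longrightarrow> (\<forall>v\<in>D x. y v = x v) \<Longrightarrow> g y = g x"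
    by metis
  have op: "open {y. \<forall>v\<in>D x. y v = x v}" if "x \<in> ?X" for x
    by (rule open_cylinder[OF D(1)[OF that]])
  have cover: "?X \<subseteq> (\<Union>x\<in>?X. {y. \<forall>v\<in>D x. y v = x v})"
    by blast
  obtain C where C: "C \<subseteq> ?X" "finite C" "?X \<subseteq> (\<Union>x\<in>C. {y. \<forall>v\<in>D x. y v = x v})"
    by (rule compactE_image[OF compact_avoiding[OF A F] op cover])
  \<comment> \<open>The common window: two points agreeing on it lie in the same cylinder of the
    finite subcover.\<close>
  obtain ws where ws: "set ws = (\<Union>x\<in>C. D x)"
    using finite_list[of "\<Union>x\<in>C. D x"] C D(1) by blast
  have g: "g x = g y" if xy: "x \<in> ?X" "y \<in> ?X" "map x ws = map y ws" for x y
  proof -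
    obtain c where c: "c \<in> C" "\<forall>v\<in>D c. x v = c v"
      using C(3) xy(1) by blast
    have eq: "x v = y v" if "v \<in> D c" for v
      using xy(3) ws c(1) that by auto
    have "g x = g c"
      using c C(1) xy(1) by (intro D(2)) auto
    moreover have "g y = g c"
      using c C(1) xy(2) eq by (intro D(2)) auto
    ultimately show ?thesis
      by simp
  qed
  define T where "T = (\<lambda>x. (map x ws, g x)) ` ?X"
  have "(\<lambda>x. map x ws) ` ?X \<subseteq> {l. set l \<subseteq> A \<and> length l = length ws}"
    by (auto simp: avoiding_def full_shift_iff)
  then have "finite ((\<lambda>x. map x ws) ` ?X)"
    using finite_lists_length_eq[OF A] by (rule finite_subset)
  \<comment> \<open>The word on the window determines the value of \<open>g\<close>, so one chosen
    point per word already produces the whole table \<open>T\<close>, and there are finitely many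
    words over \<open>A\<close>.\<close>
  then have "finite ((\<lambda>l. (l, g (SOME x. x \<in> ?X \<and> map x ws = l))) ` (\<lambda>x. map x ws) ` ?X)"
    by blast
  moreover have "g (SOME y. y \<in> ?X \<and> map y ws = map x ws) = g x" if "x \<in> ?X" for x
    using that someI[of "\<lambda>y. y \<in> ?X \<and> map y ws = map x ws" x] by (intro g) auto
  then have "T \<subseteq> (\<lambda>l. (l, g (SOME x. x \<in> ?X \<and> map x ws = l))) ` (\<lambda>x. map x ws) ` ?X"
    by (force simp: T_def image_image)
  ultimately have "finite T"
    using finite_subset by blast
  then obtain t where t: "set t = T"
    using finite_list by blast
  show ?thesis
  proof (rule that)
    fix x assume x: "x \<in> ?X"
    show "\<phi> x = local_map (ws, t) x"
    proof
      fix v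
      have sx: "shift v x \<in> ?X"
        using x by (rule shift_avoiding)
      have "map_of t (map (shift v x) ws) = Some (g (shift v x))"
      proof -
        have "(map (shift v x) ws, g (shift v x)) \<in> set t"
          using sx t by (auto simp: T_def)
        then obtain b where b: "map_of t (map (shift v x) ws) = Some b"
          by (metis weak_map_of_SomeI)
        then have "(map (shift v x) ws, b) \<in> T"
          using map_of_SomeD[OF b] t by simp
        then have "b = g (shift v x)"
          using g[OF sx] by (auto simp: T_def)
        then show ?thesis
          using b by simp
      qed
      moreover have "g (shift v x) = \<phi> x v"
        using equiv[OF x] by (simp add: g_def shift_apply)
      moreover have "map (\<lambda>w. x (v + w)) ws = map (shift v x) ws"
        by (simp add: shift_apply add.commute)
      ultimately show "\<phi> x v = local_map (ws, t) x v"
        by (simp add: local_map_def del: map_eq_conv)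
    qed
  qed
qed

text \<open>Carrying the inverse code \<open>s\<close> turns injectivity of \<open>r\<close> on
  \<open>X\<close> into a local condition.\<close>

definition embedding :: "'d::finite rule \<Rightarrow> 'd rule \<Rightarrow> 'd config set \<Rightarrow> 'd config set \<Rightarrow> bool" where
  "embedding r s X Y \<longleftrightarrow> (\<forall>x\<in>X. local_map r x \<in> Y \<and> local_map s (local_map r x) = x)"

lemma embedding_mono: "embedding r s X Y \<Longrightarrow> X' \<subseteq> X \<Longrightarrow> embedding r s X' Y"
  unfolding embedding_def by blast

text \<open>Symmetry is immediate here because \<open>s\<close> is an explicit continuous inverse;
  \<open>conjugate\<close> itself mentions continuity in one direction only.\<close>

lemma conjugate_image_embedding:
  assumes "embedding r s X Y"
  shows "conjugate X (local_map r ` X)" "conjugate (local_map r ` X) X"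
proof -
  have inv: "local_map s (local_map r x) = x" if "x \<in> X" for x
    using assms that unfolding embedding_def by blast
  have "bij_betw (local_map r) X (local_map r ` X)"
    by (rule bij_betw_byWitness[where f' = "local_map s"]) (use inv in auto)
  then show "conjugate X (local_map r ` X)"
    unfolding conjugate_def using continuous_local_map local_map_shift by blast
  have "bij_betw (local_map s) (local_map r ` X) X"
    by (rule bij_betw_byWitness[where f' = "local_map r"]) (use inv in auto)
  then show "conjugate (local_map r ` X) X"
    unfolding conjugate_def using continuous_local_map local_map_shift by blast
qed

text \<open>The image is cut out of \<open>Y\<close> by local conditions: it consists of the points
  that \<open>s\<close> sends into \<open>X\<close> and \<open>r\<close> sends back to
  themselves.\<close>

lemma is_SFT_image_embedding:
  assumes "embedding r s X Y" "is_SFT X" "is_SFT Y"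
  shows "is_SFT (local_map r ` X)"
proof -
  have "local_map r ` X = {y \<in> Y. local_map s y \<in> X \<and> local_map r (local_map s y) = y}"
    using assms(1) unfolding embedding_def by (auto simp: image_iff) metis
  then show ?thesis
    using is_SFT_fixed_points[OF assms(3,2)] by simp
qed

lemma Hausdorff_space_config: "Hausdorff_space (euclidean :: 'd::finite config topology)"
  unfolding Hausdorff_space_def
proof (intro allI impI)
  fix x y :: "'d config" assume "x \<in> topspace euclidean \<and> y \<in> topspace euclidean \<and> x \<noteq> y"
  then obtain v where v: "x v \<noteq> y v"
    by auto
  have "open {z :: 'd config. \<forall>w\<in>{v}. z w = t w}" for t
    by (rule open_cylinder) simp
  then show "\<exists>U V. openin euclidean U \<and> openin euclidean V \<and> x \<in> U \<and> y \<in> V \<and> disjnt U V"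
    using v by (intro exI[of _ "{z. \<forall>w\<in>{v}. z w = x w}"] exI[of _ "{z. \<forall>w\<in>{v}. z w = y w}"])
      (auto simp: disjnt_def)
qed

text \<open>A continuous bijection from a compact space to a Hausdorff space is a homeomorphism. The
  inverse is thus continuous too, and both maps are block codes by
  \<open>Curtis_Hedlund_Lyndon\<close>.\<close>

lemma conjugate_imp_embedding:
  assumes A: "finite A" and F: "\<And>p. p \<in> F \<Longrightarrow> finite (dom p)"
    and Y: "is_SFT Y" and conj: "conjugate (avoiding A F) Y"
  obtains r s where "embedding r s (avoiding A F) Y" "local_map r ` avoiding A F = Y"
proof -
  let ?X = "avoiding A F"
  obtain \<phi> where \<phi>: "bij_betw \<phi> ?X Y" "continuous_on ?X \<phi>"
      "\<And>u x. x \<in> ?X \<Longrightarrow> \<phi> (shift u x) = shift u (\<phi> x)"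
    using conj unfolding conjugate_def by blast
  have inj: "inj_on \<phi> ?X" and im: "\<phi> ` ?X = Y"
    using \<phi>(1) by (auto simp: bij_betw_def)
  obtain B H where H: "finite B" "\<And>p. p \<in> H \<Longrightarrow> finite (dom p)" "Y = avoiding B H"
    using Y unfolding is_SFT_def pattern_over_def by blast
  obtain r where r: "\<And>x. x \<in> ?X \<Longrightarrow> \<phi> x = local_map r x"
    using Curtis_Hedlund_Lyndon[OF A F \<phi>(2,3)] by blast
  have "compact ?X"
    by (rule compact_avoiding[OF A]) (rule F)
  then have "homeomorphic_map (top_of_set ?X) (top_of_set Y) \<phi>"
    using \<phi>(2) im inj
    by (intro continuous_imp_homeomorphic_map Hausdorff_space_subtopology Hausdorff_space_config)
      (auto simp: continuous_map_in_subtopology compact_space_subtopology)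
  then obtain \<psi> where "continuous_map (top_of_set Y) (top_of_set ?X) \<psi>"
      and \<psi>: "\<And>x. x \<in> ?X \<Longrightarrow> \<psi> (\<phi> x) = x"
    unfolding homeomorphic_map_maps homeomorphic_maps_def by auto
  then have "continuous_on Y \<psi>"
    by (simp add: continuous_map_in_subtopology)
  moreover have "\<psi> (shift u y) = shift u (\<psi> y)" if y: "y \<in> Y" for u y
  proof -
    obtain x where x: "x \<in> ?X" "y = \<phi> x"
      using y im by blast
    then have "shift u y = \<phi> (shift u x)"
      using \<phi>(3) by simp
    then show ?thesis
      using \<psi> x shift_avoiding[OF x(1)] by metis
  qed
  ultimately obtain s where s: "\<And>y. y \<in> Y \<Longrightarrow> \<psi> y = local_map s y"
    using Curtis_Hedlund_Lyndon[OF H(1,2), where \<phi> = \<psi>] unfolding H(3) by blast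
  have "\<phi> x \<in> Y" if "x \<in> ?X" for x
    using im that by blast
  then have "embedding r s ?X Y"
    unfolding embedding_def using r s \<psi> by metis
  moreover have "local_map r ` ?X = Y"
    unfolding im[symmetric] using r by (intro image_cong) auto
  ultimately show ?thesis
    by (rule that)
qed

lemma is_SFT_full_shift: "finite A \<Longrightarrow> is_SFT (full_shift A)"
  unfolding is_SFT_def avoiding_def by (intro exI[of _ A] exI[of _ "{}"]) simp

text \<open>\<open>F\<close> may be infinite, but a point of the full shift that \<open>r\<close>
  sends into \<open>Y\<close> and \<open>s\<close> recovers must lie in the subshift:
  \<open>r\<close> is onto \<open>Y\<close>, so some point of the subshift has the same image, and
  \<open>s\<close> identifies the two.\<close>

lemma is_SFT_conjugate:
  assumes A: "finite A" and F: "\<And>p. p \<in> F \<Longrightarrow> finite (dom p)"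
    and Y: "is_SFT Y" and conj: "conjugate (avoiding A F) Y"
  shows "is_SFT (avoiding A F)"
proof -
  obtain r s where rs: "embedding r s (avoiding A F) Y" "local_map r ` avoiding A F = Y"
    using conjugate_imp_embedding[OF assms] by blast
  have "avoiding A F = {x \<in> full_shift A. local_map r x \<in> Y \<and> local_map s (local_map r x) = x}"
  proof (intro equalityI subsetI)
    fix x assume "x \<in> {x \<in> full_shift A. local_map r x \<in> Y \<and> local_map s (local_map r x) = x}"
    then obtain y where "y \<in> avoiding A F" "local_map r x = local_map r y" "local_map s (local_map r x) = x"
      using rs(2) by blast
    then show "x \<in> avoiding A F"
      using rs(1) unfolding embedding_def by metis
  qed (use rs(1) in \<open>auto simp: embedding_def avoiding_def\<close>)
  then show ?thesis
    using is_SFT_fixed_points[OF is_SFT_full_shift[OF A] Y] by simp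
qed

section \<open>The finitary embedding condition\<close>

text \<open>A form that can be evaluated on association lists. Values are looked up through
  \<open>map_of\<close> because positions may be repeated.\<close>

definition violates :: "((int ^ 'd::finite) \<times> nat) list \<Rightarrow> 'd config \<Rightarrow> bool" where
  "violates q y \<longleftrightarrow> (\<exists>e\<in>set q. map_of q (fst e) \<noteq> Some (y (fst e)))"

lemma violates_iff: "violates q y \<longleftrightarrow> \<not> (\<forall>v\<in>dom (map_of q). map_of q v = Some (y v))"
  unfolding violates_def dom_map_of_conv_image_fst by auto

text \<open>The embedding condition at the origin, where \<open>Bs\<close> and \<open>Fl\<close>
  present \<open>Y\<close>. Membership in \<open>Bs\<close> is spelled out as a bounded search for
  an equal element, which matches the computability rules.\<close>

definition good ::
  "nat list \<Rightarrow> ((int ^ 'd::finite) \<times> nat) list list \<Rightarrow> 'd rule \<Rightarrow> 'd rule \<Rightarrow> 'd config \<Rightarrow> bool" where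
  "good Bs Fl r s x \<longleftrightarrow> (\<exists>b\<in>set Bs. local_map r x 0 = b) \<and>
    (\<forall>q\<in>set Fl. violates q (local_map r x)) \<and> local_map s (local_map r x) 0 = x 0"

text \<open>Covers the coordinates of x that \<open>good\<close> reads: the image under
  \<open>r\<close> is inspected at 0, at the pattern positions and on the window of
  \<open>s\<close>, and x itself at 0.\<close>

definition good_window ::
  "((int ^ 'd::finite) \<times> nat) list list \<Rightarrow> 'd rule \<Rightarrow> 'd rule \<Rightarrow> (int ^ 'd) list" where
  "good_window Fl r s = 0 # concat (map (\<lambda>v. map (\<lambda>w. v + w) (fst r))
    (0 # concat (map (map fst) Fl) @ fst s))"

lemma good_cong:
  assumes eq: "\<And>v. v \<in> set (good_window Fl r s) \<Longrightarrow> x v = y v" and good: "good Bs Fl r s x"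
  shows "good Bs Fl r s y"
proof -
  have r: "local_map r x v = local_map r y v" if "v \<in> set (0 # concat (map (map fst) Fl) @ fst s)" for v
    by (rule local_map_cong, rule eq) (use that in \<open>auto simp: good_window_def\<close>)
  have "local_map s (local_map r x) 0 = local_map s (local_map r y) 0"
    by (rule local_map_cong, rule r) simp
  moreover have "violates q (local_map r y)" if "q \<in> set Fl" for q
  proof -
    have "local_map r x (fst e) = local_map r y (fst e)" if "e \<in> set q" for e
      using that \<open>q \<in> set Fl\<close> by (intro r) auto
    then show ?thesis
      using good that unfolding good_def violates_def by metis
  qed
  moreover have "x 0 = y 0"
    by (rule eq) (simp add: good_window_def)
  ultimately show ?thesis
    using good r[of 0] by (simp add: good_def)
qed

lemma local_pred_good: "local_pred (good Bs Fl r s)"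
  by (rule local_pred_finite[of "set (good_window Fl r s)"]) (simp, rule good_cong)

text \<open>An embedding satisfies \<open>good\<close> at every translate; as the subshift is
  shift-invariant, the origin is enough.\<close>

lemma embedding_iff_good:
  assumes Y: "Y = avoiding (set Bs) (map_of ` set Fl)"
  shows "embedding r s (avoiding A F) Y \<longleftrightarrow> (\<forall>x\<in>avoiding A F. good Bs Fl r s x)"
proof -
  let ?X = "avoiding A F"
  have Y': "y \<in> Y \<longleftrightarrow> (\<forall>u. (\<exists>b\<in>set Bs. shift u y 0 = b) \<and> (\<forall>q\<in>set Fl. violates q (shift u y)))" for y
    unfolding Y avoiding_def appears_def violates_iff full_shift_iff by (auto simp: shift_apply)
  have eq: "f = (g :: 'a config) \<longleftrightarrow> (\<forall>u. shift u f 0 = shift u g 0)" for f g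
    by (auto simp: shift_apply)
  have "local_map r x \<in> Y \<and> local_map s (local_map r x) = x \<longleftrightarrow> (\<forall>u. good Bs Fl r s (shift u x))" for x
    unfolding Y' eq[of _ x] good_def local_map_shift by blast
  moreover have "(\<forall>x\<in>?X. \<forall>u. good Bs Fl r s (shift u x)) \<longleftrightarrow> (\<forall>x\<in>?X. good Bs Fl r s x)"
  proof (intro iffI ballI allI)
    fix x assume "\<forall>x\<in>?X. \<forall>u. good Bs Fl r s (shift u x)" "x \<in> ?X"
    then have "good Bs Fl r s (shift 0 x)"
      by blast
    then show "good Bs Fl r s x"
      by (simp add: shift_def)
  qed (use shift_avoiding in blast)
  ultimately show ?thesis
    unfolding embedding_def by simp
qed

text \<open>\<open>Y\<close> is a fixed parameter, so these lists enter the algorithms as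
  constants.\<close>

lemma is_SFT_lists:
  assumes "is_SFT (Y :: 'd::finite config set)"
  obtains Bs and Fl :: "((int ^ 'd) \<times> nat) list list"
  where "Y = avoiding (set Bs) (map_of ` set Fl)"
proof -
  obtain B F where F: "finite B" "finite F" "\<And>p. p \<in> F \<Longrightarrow> finite (dom p)" "Y = avoiding B F"
    using assms unfolding is_SFT_def pattern_over_def by blast
  have "\<exists>l. map_of l = p" if p: "p \<in> F" for p
  proof -
    obtain vs where "set vs = dom p"
      using finite_list[OF F(3)[OF p]] by blast
    then have "map_of (map (\<lambda>v. (v, the (p v))) vs) = p"
      by (auto simp: map_of_map_restrict restrict_map_def dom_def fun_eq_iff)
    then show ?thesis ..
  qed
  then obtain l where l: "\<And>p. p \<in> F \<Longrightarrow> map_of (l p) = p"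
    by metis
  obtain Bs ps where "set Bs = B" "set ps = F"
    using F finite_list by metis
  then have "Y = avoiding (set Bs) (map_of ` set (map l ps))"
    using F(4) l by (simp add: image_image)
  then show ?thesis
    by (rule that)
qed

lemma conjugate_iff_embedding:
  fixes Y :: "'d::finite config set" and P :: "'d config set \<Rightarrow> bool"
  assumes Y: "is_SFT Y"
    and P_conjugate: "\<And>X X'. P X \<Longrightarrow> is_SFT X' \<Longrightarrow> conjugate X' X \<Longrightarrow> P X'"
    and P_containing: "\<And>X X'. P X \<Longrightarrow> is_SFT X' \<Longrightarrow> X \<subseteq> X' \<Longrightarrow> P X'"
    and P_Y: "P Y"
    and P_strict: "\<And>X. is_subshift X \<Longrightarrow> X \<subset> Y \<Longrightarrow> \<not> P X"
    and A: "finite A" and E: "\<And>p. p \<in> E \<Longrightarrow> pattern_over A p"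
  shows "conjugate (avoiding A E) Y \<longleftrightarrow>
    (\<exists>F\<subseteq>E. finite F \<and> (\<exists>r s. embedding r s (avoiding A F) Y)) \<and>
    \<not> (\<exists>F\<subseteq>E. finite F \<and> \<not> P (avoiding A F))" (is "?conj \<longleftrightarrow> ?emb \<and> \<not> ?out")
proof
  have fin: "finite (dom p)" if "p \<in> E" for p
    using E[OF that] by (simp add: pattern_over_def)
  have SFT: "is_SFT (avoiding A F)" if "F \<subseteq> E" "finite F" for F
    unfolding is_SFT_def using A E that by blast
  {
    assume conj: ?conj
    then obtain r s where rs: "embedding r s (avoiding A E) Y"
      using conjugate_imp_embedding[OF A fin Y] by blast
    obtain Bs Fl where Bs: "Y = avoiding (set Bs) (map_of ` set Fl)"
      using is_SFT_lists[OF Y] by blast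
    have "good Bs Fl r s x" if "x \<in> avoiding A E" for x
      using rs that unfolding embedding_iff_good[OF Bs] by blast
    then obtain F U where F: "finite F" "F \<subseteq> E" "\<And>x. x \<in> full_shift A \<Longrightarrow>
        good Bs Fl r s x \<or> (\<exists>p\<in>F. \<exists>u\<in>U. \<forall>v\<in>dom p. p v = Some (shift u x v))"
      using local_pred_compactness[OF A fin local_pred_good] by metis
    then have "\<forall>x\<in>avoiding A F. good Bs Fl r s x"
      unfolding avoiding_def appears_def by blast
    then have ?emb
      unfolding embedding_iff_good[OF Bs] using F by blast
    moreover have "P (avoiding A E)"
      using P_Y is_SFT_conjugate[OF A fin Y conj] conj by (rule P_conjugate)
    then have "P (avoiding A F)" if "F \<subseteq> E" "finite F" for F
      by (rule P_containing[OF _ SFT[OF that] avoiding_mono[OF that(1)]])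
    ultimately show "?emb \<and> \<not> ?out"
      by blast
  next
    assume *: "?emb \<and> \<not> ?out"
    then obtain F r s where F: "F \<subseteq> E" "finite F" "embedding r s (avoiding A F) Y"
      by blast
    \<comment> \<open>Needed for all finite enlargements of \<open>F\<close>: below, single patterns
      of \<open>E\<close> are added to it.\<close>
    have onto: "local_map r ` avoiding A F' = Y" if F': "F \<subseteq> F'" "F' \<subseteq> E" "finite F'" for F'
    proof (rule ccontr)
      assume ne: "local_map r ` avoiding A F' \<noteq> Y"
      have emb: "embedding r s (avoiding A F') Y"
        using F(3) avoiding_mono[OF F'(1)] by (rule embedding_mono)
      then have "local_map r ` avoiding A F' \<subset> Y"
        using ne unfolding embedding_def by blast
      moreover have SFT': "is_SFT (local_map r ` avoiding A F')"
        using emb SFT[OF F'(2,3)] Y by (rule is_SFT_image_embedding)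
      moreover have "P (avoiding A F')"
        using * F' by blast
      then have "P (local_map r ` avoiding A F')"
        using SFT' conjugate_image_embedding(2)[OF emb] by (rule P_conjugate)
      ultimately show False
        using P_strict is_SFT_imp_is_subshift by blast
    qed
    have "x \<in> avoiding A E" if x: "x \<in> avoiding A F" for x
    proof -
      have "\<not> appears p x" if p: "p \<in> E" for p
      proof -
        \<comment> \<open>Adding \<open>p\<close> leaves the image equal to \<open>Y\<close>, so the
          image of \<open>x\<close> comes from some \<open>y\<close> that avoids \<open>p\<close>;
          injectivity of \<open>r\<close> on the points avoiding \<open>F\<close> gives
          \<open>y = x\<close>.\<close>
        have "local_map r ` avoiding A (insert p F) = Y"
          using F p by (intro onto) auto
        moreover have "local_map r x \<in> Y"
          using F(3) x unfolding embedding_def by blast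
        ultimately obtain y where y: "y \<in> avoiding A (insert p F)" "local_map r y = local_map r x"
          by (metis imageE)
        then have "y \<in> avoiding A F"
          by (auto simp: avoiding_def)
        then have "y = x"
          using F(3) x y(2) unfolding embedding_def by metis
        then show ?thesis
          using y(1) by (auto simp: avoiding_def)
      qed
      then show ?thesis
        using x by (auto simp: avoiding_def)
    qed
    then have "avoiding A E = avoiding A F"
      using avoiding_mono[OF F(1)] by blast
    moreover have "conjugate (avoiding A F) Y"
      using conjugate_image_embedding(1)[OF F(3)] onto[OF subset_refl F(1,2)] by simp
    ultimately show ?conj
      by simp
  }
qed

section \<open>Certificates for the embedding condition\<close>

definition pattern_list :: "nat \<Rightarrow> ((int ^ 'd::finite) \<times> nat) list" where
  "pattern_list n = map (\<lambda>e. (dec (fst (prod_decode e)), snd (prod_decode e))) (dec n)"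

text \<open>A pattern is a function and has no code of its own; computations use the underlying
  association list.\<close>

lemma pattern_decode_eq_map_of: "pattern_decode n = map_of (pattern_list n)"
  by (simp add: pattern_decode_def pattern_list_def vec_decode_eq_dec dec_list_def o_def)

lemma computable_pattern_list [computable]: "computable f \<Longrightarrow> computable (\<lambda>x. pattern_list (f x))"
  unfolding pattern_list_def by (intro computable)

definition symbols :: "nat \<Rightarrow> nat list" where
  "symbols a = filter (\<lambda>s. s \<in> set_decode a) [0..<a]"

text \<open>The search bound \<open>a\<close> is sufficient: a symbol s in the set contributes 2^s
  to the mask, and s < 2^s \<le> a.\<close>

lemma set_symbols: "set (symbols a) = set_decode a"
proof -
  have "s < a" if "s \<in> set_decode a" for s
  proof -
    have "a div 2 ^ s \<noteq> 0"
      using that unfolding set_decode_def by (metis even_zero mem_Collect_eq)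
    then have "2 ^ s \<le> a"
      by (metis div_less not_less)
    then show ?thesis
      using less_exp[of s] by linarith
  qed
  then show ?thesis
    unfolding symbols_def by auto
qed

lemma computable_symbols [computable]:
  assumes f: "computable f"
  shows "computable (\<lambda>x. symbols (f x))"
  unfolding symbols_def by (intro computable f computable_compose[OF f])

text \<open>If \<open>ws\<close> repeats a position, it may receive different symbols; this is
  harmless, as assignments are always read through \<open>map_of\<close>.\<close>

definition assignments :: "'v list \<Rightarrow> 'a list \<Rightarrow> ('v \<times> 'a) list list" where
  "assignments ws as = foldr (\<lambda>w ps. concat (map (\<lambda>a. map (\<lambda>p. (w, a) # p) ps) as)) ws [[]]"

lemma set_assignments: "p \<in> set (assignments ws as) \<longleftrightarrow> map fst p = ws \<and> snd ` set p \<subseteq> set as"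
proof (induction ws arbitrary: p)
  case Nil
  then show ?case
    by (auto simp: assignments_def)
next
  case (Cons w ws)
  have "p \<in> set (assignments (w # ws) as) \<longleftrightarrow> (\<exists>a\<in>set as. \<exists>p'\<in>set (assignments ws as). p = (w, a) # p')"
    by (auto simp: assignments_def)
  then have "p \<in> set (assignments (w # ws) as) \<longleftrightarrow>
      (\<exists>a\<in>set as. \<exists>p'. (map fst p' = ws \<and> snd ` set p' \<subseteq> set as) \<and> p = (w, a) # p')"
    by (simp add: Bex_def Cons.IH)
  then show ?case
    by (cases p) auto
qed

lemma computable_assignments [computable]:
  assumes f: "computable f" and g: "computable g"
  shows "computable (\<lambda>x. assignments (f x) (g x))"
  unfolding assignments_def by (intro computable f computable_compose[OF g])

definition default_config :: "nat \<Rightarrow> ((int ^ 'd::finite) \<times> nat) list \<Rightarrow> 'd config" where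
  "default_config a p v = (case map_of p v of None \<Rightarrow> a | Some b \<Rightarrow> b)"

lemma computable_local_map [computable]:
  assumes r: "computable r" and x: "computable (\<lambda>z. x (fst z) (snd z))" and v: "computable v"
  shows "computable (\<lambda>z. local_map (r z) (x z) (v z))"
  unfolding local_map_def
  by (intro computable r v computable_split[OF x] computable_compose[OF v])

lemma computable_violates:
  assumes q: "computable q" and y: "computable (\<lambda>z. y (fst z) (snd z))"
  shows "computable (\<lambda>z. violates (q z) (y z))"
  unfolding violates_def
  by (intro computable q computable_split[OF y] computable_compose[OF q])

lemma computable_good:
  assumes r: "computable r" and s: "computable s" and x: "computable (\<lambda>z. x (fst z) (snd z))"
  shows "computable (\<lambda>z. good Bs Fl (r z) (s z) (x z))"
  unfolding good_def
  by (intro computable_violates computable r s computable_split[OF x] computable_compose[OF r]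
      computable_compose[OF s])

lemma computable_good_window:
  assumes r: "computable r" and s: "computable s"
  shows "computable (\<lambda>z. good_window Fl (r z) (s z))"
  unfolding good_window_def by (intro computable r s computable_compose[OF r])

text \<open>A position not covered by \<open>p\<close> gives \<open>None\<close> and never matches,
  so the whole occurrence has to lie inside the assigned window.\<close>

definition occurs :: "((int ^ 'd::finite) \<times> nat) list \<Rightarrow> int ^ 'd \<Rightarrow> ((int ^ 'd) \<times> nat) list \<Rightarrow> bool" where
  "occurs q u p \<longleftrightarrow> (\<forall>e\<in>set q. map_of q (fst e) = map_of p (fst e + u))"

lemma occurs_iff: "occurs q u p \<longleftrightarrow> (\<forall>v\<in>dom (map_of q). map_of q v = map_of p (v + u))"
  unfolding occurs_def dom_map_of_conv_image_fst by auto

text \<open>The finite check behind \<open>local_pred_compactness\<close>. Since \<open>ws\<close>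
  contains the window of \<open>good\<close>, the filling symbol 0 outside \<open>ws\<close> cannot
  influence the outcome.\<close>

definition certificate ::
  "nat list \<Rightarrow> ((int ^ 'd::finite) \<times> nat) list list \<Rightarrow> nat \<Rightarrow> nat list \<Rightarrow> 'd rule \<Rightarrow> 'd rule \<Rightarrow>
    (int ^ 'd) list \<Rightarrow> (int ^ 'd) list \<Rightarrow> bool" where
  "certificate Bs Fl a cs r s ws us \<longleftrightarrow>
    (\<forall>v\<in>set (good_window Fl r s). \<exists>w\<in>set ws. v = w) \<and>
    (\<forall>p\<in>set (assignments ws (symbols a)).
      good Bs Fl r s (default_config 0 p) \<or> (\<exists>c\<in>set cs. \<exists>u\<in>set us. occurs (pattern_list c) u p))"

lemma computable_certificate:
  assumes "computable a" "computable cs" and r: "computable r" and s: "computable s"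
    and "computable ws" and us: "computable us"
  shows "computable (\<lambda>z. certificate Bs Fl (a z) (cs z) (r z) (s z) (ws z) (us z))"
  unfolding certificate_def occurs_def default_config_def
  by (intro computable_good computable_good_window computable
      computable_compose[OF r] computable_compose[OF s] computable_compose[OF us]
      computable_compose[OF assms(1)] computable_compose[OF assms(2)] computable_compose[OF assms(5)] assms)

text \<open>From left to right, the restriction of a point to \<open>ws\<close> contains no
  forbidden pattern and must therefore be good, which only depends on \<open>ws\<close>. The
  converse is compactness, with \<open>ws\<close> chosen large enough to display every
  occurrence.\<close>

lemma ex_certificate_iff:
  fixes r s :: "'d::finite rule"
  shows "(\<exists>ws us. certificate Bs Fl a cs r s ws us) \<longleftrightarrow>
    (\<forall>x\<in>avoiding (set_decode a) (pattern_decode ` set cs). good Bs Fl r s x)"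
proof (intro iffI ballI)
  fix x :: "'d config"
  assume "\<exists>ws us. certificate Bs Fl a cs r s ws us"
    and x: "x \<in> avoiding (set_decode a) (pattern_decode ` set cs)"
  then obtain ws us where cert: "certificate Bs Fl a cs r s ws us"
    by blast
  let ?p = "map (\<lambda>w. (w, x w)) ws"
  have p: "map_of ?p v = (if v \<in> set ws then Some (x v) else None)" for v
    by (induction ws) auto
  have "?p \<in> set (assignments ws (symbols a))"
    using x by (auto simp: set_assignments set_symbols avoiding_def full_shift_iff o_def)
  moreover have "\<not> occurs (pattern_list c) u ?p" if "c \<in> set cs" for c u
  proof
    assume occ: "occurs (pattern_list c) u ?p"
    have "pattern_decode c v = Some (shift u x v)" if "v \<in> dom (pattern_decode c)" for v
    proof -
      have "pattern_decode c v = map_of ?p (v + u)"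
        using occ that unfolding occurs_iff pattern_decode_eq_map_of by blast
      then show ?thesis
        using that p by (auto simp: shift_apply split: if_splits)
    qed
    then have "appears (pattern_decode c) x"
      unfolding appears_def by blast
    then show False
      using x \<open>c \<in> set cs\<close> by (auto simp: avoiding_def)
  qed
  ultimately have "good Bs Fl r s (default_config 0 ?p)"
    using cert unfolding certificate_def by blast
  moreover have "default_config 0 ?p v = x v" if "v \<in> set (good_window Fl r s)" for v
    using cert that unfolding certificate_def default_config_def p by auto
  ultimately show "good Bs Fl r s x"
    by (rule good_cong[rotated])
next
  assume good: "\<forall>x\<in>avoiding (set_decode a) (pattern_decode ` set cs). good Bs Fl r s x"
  let ?F = "pattern_decode ` set cs :: 'd pattern set"
  have fin: "finite (dom p)" if "p \<in> ?F" for p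
    using that by (auto simp: pattern_decode_eq_map_of finite_dom_map_of)
  \<comment> \<open>The pattern set is finite already; compactness is used for the finite set
    \<open>U\<close> of positions.\<close>
  obtain F U where F: "F \<subseteq> ?F" "finite U" "\<And>x. x \<in> full_shift (set_decode a) \<Longrightarrow>
      good Bs Fl r s x \<or> (\<exists>p\<in>F. \<exists>u\<in>U. \<forall>v\<in>dom p. p v = Some (shift u x v))"
  proof (rule local_pred_compactness[where A = "set_decode a" and F = ?F and G = "good Bs Fl r s"])
    fix F :: "'d pattern set" and U
    assume "F \<subseteq> ?F" "finite U" "\<And>x. x \<in> full_shift (set_decode a) \<Longrightarrow>
      good Bs Fl r s x \<or> (\<exists>p\<in>F. \<exists>u\<in>U. \<forall>v\<in>dom p. p v = Some (shift u x v))"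
    then show thesis
      by (rule that)
  qed (use fin good in \<open>simp_all only: local_pred_good finite_set_decode\<close>)
  obtain us where us: "set us = U"
    using finite_list[OF F(2)] by blast
  \<comment> \<open>Besides the window of \<open>good\<close>, \<open>ws\<close> has to contain each
    pattern translated by each element of \<open>U\<close>, so that an occurrence in an extension is
    already visible in the assignment.\<close>
  have "finite (set (good_window Fl r s) \<union> (\<Union>p\<in>?F. \<Union>u\<in>U. (\<lambda>v. v + u) ` dom p))"
    by (intro finite_UnI finite_UN_I finite_imageI finite_set fin F(2))
  from finite_list[OF this]
  obtain ws where ws: "set ws = set (good_window Fl r s) \<union> (\<Union>p\<in>?F. \<Union>u\<in>U. (\<lambda>v. v + u) ` dom p)" ..
  have "good Bs Fl r s (default_config 0 p) \<or> (\<exists>c\<in>set cs. \<exists>u\<in>set us. occurs (pattern_list c) u p)"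
    if p: "p \<in> set (assignments ws (symbols a))" for p
  proof -
    have "map fst p = ws" and ran: "snd ` set p \<subseteq> set_decode a"
      using p by (simp_all add: set_assignments set_symbols)
    then have dom: "dom (map_of p) = set ws"
      by (auto simp only: dom_map_of_conv_image_fst set_map)
    \<comment> \<open>As 0 is always in the window, an assignment contains at least one symbol; over
      the empty alphabet there is no assignment to check.\<close>
    have "0 \<in> set ws"
      by (simp add: ws good_window_def)
    then obtain b where b: "map_of p 0 = Some b"
      using dom by blast
    have ran': "b' \<in> set_decode a" if "map_of p v = Some b'" for v b'
      using map_of_SomeD[OF that] ran by force
    \<comment> \<open>0 need not be a symbol, so the assignment is extended by a symbol occurring in it\<close>
    let ?x = "default_config b p"
    have x: "map_of p v = Some (?x v)" if "v \<in> set ws" for v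
      using that unfolding dom[symmetric] by (auto simp: default_config_def)
    have "?x \<in> full_shift (set_decode a)"
      using ran' b by (auto simp: full_shift_iff default_config_def split: option.split)
    from F(3)[OF this] show ?thesis
    proof
      assume "good Bs Fl r s ?x"
      moreover have "?x v = default_config 0 p v" if "v \<in> set (good_window Fl r s)" for v
      proof -
        have "v \<in> dom (map_of p)"
          using that ws dom by blast
        then show ?thesis
          by (auto simp: default_config_def)
      qed
      ultimately show ?thesis
        using good_cong by blast
    next
      assume "\<exists>q\<in>F. \<exists>u\<in>U. \<forall>v\<in>dom q. q v = Some (shift u ?x v)"
      then obtain q u where q: "q \<in> F" "u \<in> U" "\<And>v. v \<in> dom q \<Longrightarrow> q v = Some (?x (v + u))"
        by (auto simp: shift_apply)
      then obtain c where c: "c \<in> set cs" "q = map_of (pattern_list c)"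
        using F(1) by (auto simp: pattern_decode_eq_map_of)
      have "q v = map_of p (v + u)" if "v \<in> dom q" for v
      proof -
        have "v + u \<in> set ws"
          unfolding ws using q(1,2) F(1) that by (intro UnI2 UN_I[of q] UN_I[of u] imageI) auto
        then show ?thesis
          using x q(3)[OF that] by simp
      qed
      then have "occurs (pattern_list c) u p"
        unfolding occurs_iff c(2) by blast
      then show ?thesis
        using c(1) q(2) us by blast
    qed
  qed
  then show "\<exists>ws us. certificate Bs Fl a cs r s ws us"
    unfolding certificate_def using ws by blast
qed

section \<open>The conjugacy problem\<close>

text \<open>The argument \<open>T\<close> fixes the dimension, which the number \<open>c\<close>
  does not reveal.\<close>

definition listed :: "nat \<Rightarrow> tm \<Rightarrow> nat \<Rightarrow> 'd::finite itself \<Rightarrow> bool" where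
  "listed a M c T \<longleftrightarrow> pattern_over (set_decode a) (pattern_decode c :: 'd pattern) \<and>
    (\<exists>n. tm_outputs M n c)"

lemma enumerated_patterns_listed:
  "(enumerated_patterns (set_decode a) M :: 'd::finite pattern set) =
    pattern_decode ` {c. listed a M c TYPE('d)}"
  unfolding enumerated_patterns_def listed_def by auto

text \<open>Replaces finite sets of patterns by lists of codes, which can be searched and passed to
  a machine.\<close>

lemma ex_finite_enumerated_iff:
  "(\<exists>F\<subseteq>enumerated_patterns (set_decode a) M. finite F \<and> Q F) \<longleftrightarrow>
    (\<exists>cs. (\<forall>c\<in>set cs. listed a M c TYPE('d::finite)) \<and> Q (pattern_decode ` set cs :: 'd pattern set))"
proof
  assume "\<exists>F\<subseteq>enumerated_patterns (set_decode a) M. finite F \<and> Q F"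
  then obtain C where C: "C \<subseteq> {c. listed a M c TYPE('d)}" "finite C" "Q (pattern_decode ` C)"
    unfolding enumerated_patterns_listed by (metis finite_subset_image)
  then show "\<exists>cs. (\<forall>c\<in>set cs. listed a M c TYPE('d)) \<and> Q (pattern_decode ` set cs)"
    using finite_list[OF C(2)] by blast
next
  assume "\<exists>cs. (\<forall>c\<in>set cs. listed a M c TYPE('d)) \<and> Q (pattern_decode ` set cs)"
  then obtain cs where "\<forall>c\<in>set cs. listed a M c TYPE('d)" "Q (pattern_decode ` set cs)"
    by blast
  then show "\<exists>F\<subseteq>enumerated_patterns (set_decode a) M. finite F \<and> Q F"
    unfolding enumerated_patterns_listed by (intro exI[of _ "pattern_decode ` set cs"]) auto
qed

lemma semicomputable_tm_outputs':
  "computable M \<Longrightarrow> computable n \<Longrightarrow> computable m \<Longrightarrow> semicomputable (\<lambda>x. tm_outputs (M x) (n x) (m x))"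
  using semicomputable_compose[OF semicomputable_tm_outputs, of "\<lambda>x. (M x, n x, m x)"]
  by (simp add: computable_Pair)

lemma semicomputable_listed:
  assumes a: "computable a" and M: "computable M" and c: "computable c"
  shows "semicomputable (\<lambda>x. listed (a x) (M x) (c x) TYPE('d::finite))"
proof -
  \<comment> \<open>Symbols are looked up through \<open>map_of\<close> because an entry shadowed by
    an earlier one may carry a symbol outside the alphabet. Finiteness of the domain is
    automatic.\<close>
  have over: "pattern_over (set_decode k) (pattern_decode n :: 'd pattern) \<longleftrightarrow>
    (\<forall>e\<in>set (pattern_list n :: ((int ^ 'd) \<times> nat) list).
      case map_of (pattern_list n) (fst e) of None \<Rightarrow> True | Some s \<Rightarrow> s \<in> set_decode k)" for k n
  proof -
    have "(case map_of q (fst e) of None \<Rightarrow> True | Some s \<Rightarrow> s \<in> set_decode k) \<longleftrightarrow>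
        (\<forall>s. map_of q (fst e) = Some s \<longrightarrow> s \<in> set_decode k)" for q :: "((int ^ 'd) \<times> nat) list" and e :: "(int ^ 'd) \<times> nat"
      by (auto split: option.split)
    moreover have "ran (map_of q) \<subseteq> S \<longleftrightarrow> (\<forall>e\<in>set q. \<forall>s. map_of q (fst e) = Some s \<longrightarrow> s \<in> S)"
      for q :: "((int ^ 'd) \<times> nat) list" and S
      by (auto simp: ran_def dest: map_of_SomeD) (metis fst_conv map_of_SomeD)
    ultimately show ?thesis
      by (simp add: pattern_over_def pattern_decode_eq_map_of finite_dom_map_of)
  qed
  have 1: "computable (\<lambda>x. pattern_over (set_decode (a x)) (pattern_decode (c x) :: 'd pattern))"
    unfolding over by (intro computable a c computable_compose[OF a] computable_compose[OF c])
  have 2: "semicomputable (\<lambda>x. \<exists>n. tm_outputs (M x) n (c x))"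
    by (intro semicomputable_Ex semicomputable_tm_outputs' computable_compose[OF M] computable_compose[OF c] computable)
  show ?thesis
    unfolding listed_def by (rule semicomputable_conj[OF semicomputable_computable[OF 1] 2])
qed

theorem theorem8p3:
  fixes Y :: "'d::finite config set" and P :: "'d config set \<Rightarrow> bool"
  assumes Y_SFT: "is_SFT Y"
    and P_SFT: "\<And>X. P X \<Longrightarrow> is_SFT X"
    and i_conjugate: "\<And>X X'. P X \<Longrightarrow> is_SFT X' \<Longrightarrow> conjugate X' X \<Longrightarrow> P X'"
    and i_containing: "\<And>X X'. P X \<Longrightarrow> is_SFT X' \<Longrightarrow> X \<subseteq> X' \<Longrightarrow> P X'"
    and ii_Y: "P Y"
    and ii_strict: "\<And>X. is_subshift X \<Longrightarrow> X \<subset> Y \<Longrightarrow> \<not> P X"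
    and iii: "\<exists>M. semidecides_SFT M (\<lambda>X. \<not> P X)"
  shows "D_Sigma01 (conjugacy_problem Y)"
proof -
  obtain Bs Fl where Y: "Y = avoiding (set Bs) (map_of ` set Fl)"
    using is_SFT_lists[OF Y_SFT] by blast
  obtain N where N: "semidecides_SFT N (\<lambda>X. \<not> P X)"
    using iii by blast
  let ?listed = "\<lambda>(z :: nat \<times> tm) c. listed (fst z) (snd z) c TYPE('d)"
  define B where "B z \<longleftrightarrow> (\<exists>cs. (\<forall>c\<in>set cs. ?listed z c) \<and>
    (\<exists>r s :: 'd rule. \<exists>ws us. certificate Bs Fl (fst z) cs r s ws us))" for z
  \<comment> \<open>The guard keeps the inputs of \<open>N\<close> within the range where
    \<open>semidecides_SFT\<close> describes its halting.\<close>
  define C where "C z \<longleftrightarrow> (\<exists>cs. (\<forall>c\<in>set cs. ?listed z c) \<and>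
    (\<exists>m. tm_outputs N (prod_encode (fst z, enc cs)) m))" for z :: "nat \<times> tm"
  have "semicomputable B"
    unfolding B_def
    by (intro semicomputable_Ex semicomputable_conj semicomputable_Ball_set semicomputable_listed
        semicomputable_computable[OF computable_certificate] computable)
  moreover have "computable (\<lambda>n :: nat. enc (dec n :: nat \<times> tm) = n)"
    by (intro computable)
  \<comment> \<open>\<open>dec\<close> also accepts numbers that code no machine. The test
    \<open>enc (dec n) = n\<close> excludes them, and imposing it on the set from which the other is
    subtracted suffices.\<close>
  ultimately have "Sigma01 {n. enc (dec n :: nat \<times> tm) = n \<and> B (dec n)}"
    by (intro Sigma01_semicomputable semicomputable_conj[OF semicomputable_computable]
        semicomputable_compose[OF _ computable_dec[OF computable_id]])
  moreover have "semicomputable C"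
    unfolding C_def
    by (intro semicomputable_Ex semicomputable_conj semicomputable_Ball_set semicomputable_listed
        semicomputable_tm_outputs' computable)
  then have "Sigma01 {n. C (dec n)}"
    by (intro Sigma01_semicomputable semicomputable_compose[OF _ computable_dec[OF computable_id]])
  moreover have *: "conjugate (effective_subshift (set_decode a) M) Y \<longleftrightarrow> B (a, M) \<and> \<not> C (a, M)" for a M
  proof -
    have "tm_halts N (prod_encode (a, enc cs)) \<longleftrightarrow> \<not> P (avoiding (set_decode a) (pattern_decode ` set cs))"
      if "\<forall>c\<in>set cs. listed a M c TYPE('d)" for cs
    proof -
      have "enc cs = list_encode cs"
        by (simp add: enc_list_def map_idI)
      moreover have "\<forall>c\<in>set cs. pattern_over (set_decode a) (pattern_decode c :: 'd pattern)"
        using that by (auto simp: listed_def)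
      ultimately show ?thesis
        using N[unfolded semidecides_SFT_def, rule_format, OF finite_set_decode, of cs a] by simp
    qed
    then have "C (a, M) \<longleftrightarrow> (\<exists>F\<subseteq>enumerated_patterns (set_decode a) M. finite F \<and> \<not> P (avoiding (set_decode a) F))"
      unfolding ex_finite_enumerated_iff C_def tm_halts_def[symmetric] by auto
    moreover have "B (a, M) \<longleftrightarrow> (\<exists>F\<subseteq>enumerated_patterns (set_decode a) M. finite F \<and>
        (\<exists>r s. embedding r s (avoiding (set_decode a) F) Y))"
      unfolding ex_finite_enumerated_iff B_def ex_certificate_iff embedding_iff_good[OF Y] by simp
    moreover have "pattern_over (set_decode a) p" if "p \<in> enumerated_patterns (set_decode a) M" for p :: "'d pattern"
      using that by (simp add: enumerated_patterns_def)
    then have "conjugate (effective_subshift (set_decode a) M) Y \<longleftrightarrow>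
      (\<exists>F\<subseteq>enumerated_patterns (set_decode a) M. finite F \<and>
        (\<exists>r s. embedding r s (avoiding (set_decode a) F) Y)) \<and>
      \<not> (\<exists>F\<subseteq>enumerated_patterns (set_decode a) M. finite F \<and> \<not> P (avoiding (set_decode a) F))"
      unfolding effective_subshift_def
      by (intro conjugate_iff_embedding[where P = P])
        (rule Y_SFT, erule (2) i_conjugate, erule (2) i_containing, rule ii_Y, erule (1) ii_strict,
          rule finite_set_decode)
    ultimately show ?thesis
      by simp
  qed
  have "n \<in> conjugacy_problem Y \<longleftrightarrow> enc (dec n :: nat \<times> tm) = n \<and> B (dec n) \<and> \<not> C (dec n)" for n
  proof -
    \<comment> \<open>Finite alphabets correspond bijectively to their masks, so the alphabet may be
      replaced by an arbitrary number \<open>a\<close>.\<close>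
    have "n \<in> conjugacy_problem Y \<longleftrightarrow>
        (\<exists>a M. n = enc (a, M) \<and> conjugate (effective_subshift (set_decode a) M) Y)"
      unfolding conjugacy_problem_def
      by (auto simp: enc_prod_def tm_encode_eq_enc)
        (metis finite_set_decode set_decode_inverse set_encode_inverse)+
    also have "\<dots> \<longleftrightarrow> enc (dec n :: nat \<times> tm) = n \<and> B (dec n) \<and> \<not> C (dec n)"
      unfolding * by (metis dec_enc prod.collapse)
    finally show ?thesis .
  qed
  then have "conjugacy_problem Y = {n. enc (dec n :: nat \<times> tm) = n \<and> B (dec n)} - {n. C (dec n)}"
    by blast
  ultimately show ?thesis
    unfolding D_Sigma01_def by blast
qed

end
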